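(* Let $\Omega$, $\delta$, $\sigma$, $\sigma_h$ and the two-point density $D^\delta(z,w;h)$ be as in the context, and let $(z,w)\in\Omega^2$ with $|z-w|\le 1/C$, $C>1$ large enough. Then: (i) for $h^{4/7}\ll|z-w|\ll h^{1/2}$, $$D^{\delta}(z,w;h)=\frac{\sigma_h^3(z,w)|z-w|^2}{(4\pi)^2h^3}\Bigl(1+\mathcal O\Bigl(\frac{|z-w|^2}{h}+\delta h^{-8/5}\Bigr)\Bigr);$$ (ii) for $|z-w|\gg(h\ln h^{-1})^{1/2}$, $$D^{\delta}(z,w;h)=\frac{\sigma(z)\sigma(w)+\mathcal O(h)}{(2h\pi)^2}\Bigl(1+\mathcal O\bigl(\delta h^{-8/5}\bigr)\Bigr).$$
   Context: Operator. Let $0<h\ll1$, $S^1=\mathbb R/2\pi\mathbb Z$, $D_x=\frac1i\frac{d}{dx}$ and $P_h=hD_x+g(x)$ on $L^2(S^1)$, where $g\in C^\infty(S^1;\mathbb C)$ is such that $\mathrm{Im}\,g$ has exactly two critical points, both non-degenerate: a minimum at $a$ and a maximum at $b$. Let $p(x,\xi)=\xi+g(x)$ on $T^*S^1$, $\{p,\overline p\}=p'_\xi\,\overline p'_x-p'_x\,\overline p'_\xi$, and $\Sigma=\overline{p(T^*S^1)}$. For $z\in\mathring\Sigma$ the equation $p=z$ has exactly two solutions $\rho_\pm(z)=(x_\pm(z),\xi_\pm(z))$, where $\mathrm{Im}\,g(x_\pm)=\mathrm{Im}\,z$, $\pm\mathrm{Im}\,g'(x_\pm)<0$, $\xi_\pm=\mathrm{Re}\,z-\mathrm{Re}\,g(x_\pm)$.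 Points of $S^1$ are lifted to $\mathbb R$ so that $b-2\pi<x_+<a<x_-<b$. Set $$\sigma(z)=\frac{2i}{\{p,\overline p\}(\rho_+(z))}+\frac{2i}{\{\overline p,p\}(\rho_-(z))}.$$ Domain. $\Omega\Subset\mathring\Sigma$ is open, convex, relatively compact, simply connected, with $\mathrm{dist}(\Omega,\partial\Sigma)>1/C$ for some $C>1$ independent of $h$. Perturbation. $P_h^\delta=P_h+\delta Q_\omega$, $Q_\omega u=\sum_{|j|,|k|\le\lfloor C_1/h\rfloor}\alpha_{j,k}(u|e^k)e^j$, with $C_1>0$ a large enough constant, $e^k(x)=(2\pi)^{-1/2}e^{ikx}$, and $\alpha_{j,k}$ independent standard complex Gaussian $\mathcal N_{\mathbb C}(0,1)$. Let $N=(2\lfloor C_1/h\rfloor+1)^2$ and let $B(0,R)\subset\mathbb C^N$ be the open ball of radius $R=C'/h$, $C'>0$ large enough. Coupling constant. Let $S(z)=\min\bigl(\mathrm{Im}\int_{x_+}^{x_-}(z-g(y))dy,\ \mathrm{Im}\int_{x_+}^{x_--2\pi}(z-g(y))dy\bigr)$. We assume $\delta=\sqrt h\,e^{-\epsilon_0(h)/h}$ with $(\kappa-\frac12)h\ln(h^{-1})+C_0h\le\epsilon_0(h)<\min_{z\in\overline\Omega}S(z)/C_0$ for some $\kappa>52/10$ and some large $C_0>0$, uniformly in $h$. Two-point density. The measure $\nu$ is defined by $\mathbb E[\sum_{z,w\in\sigma(P_h^\delta),z\ne w}\varphi(z,w)\mathbf 1_{B(0,R)}(\alpha)]=\int\varphi\,d\nu$,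 $\varphi\in C_0(\Omega^2)$. With $D_h(\Omega,c)=\{(z,w)\in\Omega^2:|z-w|\le c\,h^{3/5}\}$, there are constants $c,D>0$ such that on $\{(z,w)\in\Omega^2\setminus D_h(\Omega,c):|z-w|\le1/C\}$ the measure $\nu$ has a smooth Lebesgue density $D^\delta(z,w;h)$, and there are smooth functions $\sigma_h(z,w)=\sigma(\frac{z+w}2)+\mathcal O(h)$ and $K=K(z,w;h)=\sigma_h(z,w)\frac{|z-w|^2}{4h}(1+\mathcal O(|z-w|+h^\infty))$ such that $$D^{\delta}=\frac{\Lambda}{(2\pi h)^2(1-e^{-2K})}\bigl(1+\mathcal O(\delta h^{-8/5})\bigr)+\mathcal O(e^{-D/h^2}),$$ $$\Lambda=\sigma_h(z,z)\sigma_h(w,w)+\sigma_h(z,w)^2(1+\mathcal O(|z-w|))e^{-2K}+\frac{\sigma_h(z,w)^2(1+\mathcal O(|z-w|))}{e^K\sinh K}(2K^2\coth K-4K)+\mathcal O(h^\infty+\delta h^{-32/10}).$$ These are the $D^\delta$ and $\sigma_h$ of the claim. Conventions: $A\gg B$ means $A\ge MB$ with a sufficiently large constant $M$ (similarly $\ll$); all $\mathcal O$ are uniform in $(z,w)$ as $h\to0^+$. *)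

theory Defs
  imports "HOL-Analysis.Analysis" "HOL-Library.Landau_Symbols"
begin

text \<open>\<open>Ck n U f\<close> is the usual notion of \<open>C\<^sup>n\<close> on open sets \<open>U\<close>. On an arbitrary set, smooth means:
  restriction of a smooth function on an open neighbourhood.\<close>

primrec Ck :: "nat \<Rightarrow> 'a::euclidean_space set \<Rightarrow> ('a \<Rightarrow> 'b::real_normed_vector) \<Rightarrow> bool" where
  "Ck 0 U f \<longleftrightarrow> continuous_on U f"
| "Ck (Suc n) U f \<longleftrightarrow>
     (\<exists>f'. (\<forall>x\<in>U. (f has_derivative f' x) (at x)) \<and> (\<forall>v. Ck n U (\<lambda>x. f' x v)))"

definition smooth_on :: "'a::euclidean_space set \<Rightarrow> ('a \<Rightarrow> 'b::real_normed_vector) \<Rightarrow> bool" where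
  "smooth_on S f \<longleftrightarrow>
     (\<exists>U F. open U \<and> S \<subseteq> U \<and> (\<forall>n. Ck n U F) \<and> (\<forall>x\<in>S. F x = f x))"

text \<open>Functions on the circle are represented by \<open>2\<pi>\<close>-periodic functions on the line.\<close>

definition periodic :: "(real \<Rightarrow> complex) \<Rightarrow> bool" where
  "periodic f \<longleftrightarrow> (\<forall>x. f (x + 2 * pi) = f x)"

definition admissible :: "(real \<Rightarrow> complex) \<Rightarrow> real \<Rightarrow> real \<Rightarrow> bool" where
  "admissible g a b \<longleftrightarrow>
     smooth_on UNIV g \<and> periodic g \<and> b - 2 * pi < a \<and> a < b \<and>
     {x \<in> {b - 2 * pi<..b}. deriv (\<lambda>y. Im (g y)) x = 0} = {a, b} \<and>
     (\<forall>x. Im (g a) \<le> Im (g x)) \<and> (\<forall>x. Im (g x) \<le> Im (g b)) \<and>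
     deriv (deriv (\<lambda>y. Im (g y))) a \<noteq> 0 \<and> deriv (deriv (\<lambda>y. Im (g y))) b \<noteq> 0"

definition symb :: "(real \<Rightarrow> complex) \<Rightarrow> real \<times> real \<Rightarrow> complex" where
  "symb g = (\<lambda>(x, \<xi>). complex_of_real \<xi> + g x)"

definition Sigma_set :: "(real \<Rightarrow> complex) \<Rightarrow> complex set" where
  "Sigma_set g = closure (range (symb g))"

definition poisson ::
  "(real \<times> real \<Rightarrow> complex) \<Rightarrow> (real \<times> real \<Rightarrow> complex) \<Rightarrow> real \<times> real \<Rightarrow> complex" where
  "poisson p q = (\<lambda>(x, \<xi>).
     vector_derivative (\<lambda>\<eta>. p (x, \<eta>)) (at \<xi>) * vector_derivative (\<lambda>y. q (y, \<xi>)) (at x)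
   - vector_derivative (\<lambda>y. p (y, \<xi>)) (at x) * vector_derivative (\<lambda>\<eta>. q (x, \<eta>)) (at \<xi>))"

definition x_plus :: "(real \<Rightarrow> complex) \<Rightarrow> real \<Rightarrow> real \<Rightarrow> complex \<Rightarrow> real" where
  "x_plus g a b z =
     (THE x. b - 2 * pi < x \<and> x < a \<and> Im (g x) = Im z \<and> deriv (\<lambda>y. Im (g y)) x < 0)"

definition x_minus :: "(real \<Rightarrow> complex) \<Rightarrow> real \<Rightarrow> real \<Rightarrow> complex \<Rightarrow> real" where
  "x_minus g a b z =
     (THE x. a < x \<and> x < b \<and> Im (g x) = Im z \<and> deriv (\<lambda>y. Im (g y)) x > 0)"

definition rho_plus :: "(real \<Rightarrow> complex) \<Rightarrow> real \<Rightarrow> real \<Rightarrow> complex \<Rightarrow> real \<times> real" where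
  "rho_plus g a b z = (x_plus g a b z, Re z - Re (g (x_plus g a b z)))"

definition rho_minus :: "(real \<Rightarrow> complex) \<Rightarrow> real \<Rightarrow> real \<Rightarrow> complex \<Rightarrow> real \<times> real" where
  "rho_minus g a b z = (x_minus g a b z, Re z - Re (g (x_minus g a b z)))"

text \<open>Both brackets are purely imaginary, so taking the real part only changes the type.\<close>

definition sigma :: "(real \<Rightarrow> complex) \<Rightarrow> real \<Rightarrow> real \<Rightarrow> complex \<Rightarrow> real" where
  "sigma g a b z =
     Re (2 * \<i> / poisson (symb g) (\<lambda>\<rho>. cnj (symb g \<rho>)) (rho_plus g a b z)
       + 2 * \<i> / poisson (\<lambda>\<rho>. cnj (symb g \<rho>)) (symb g) (rho_minus g a b z))"

text \<open>The second integral is oriented: its upper limit lies to the left of its lower limit.\<close>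

definition S_fun :: "(real \<Rightarrow> complex) \<Rightarrow> real \<Rightarrow> real \<Rightarrow> complex \<Rightarrow> real" where
  "S_fun g a b z =
     min (Im (LBINT y = ereal (x_plus g a b z)..ereal (x_minus g a b z). z - g y))
         (Im (LBINT y = ereal (x_plus g a b z)..ereal (x_minus g a b z - 2 * pi). z - g y))"

text \<open>Elements of \<open>L\<^sup>2(S\<^sup>1)\<close> are represented by functions considered almost everywhere on the
  fundamental domain \<open>[0, 2\<pi>]\<close>.\<close>

abbreviation circle :: "real measure" where
  "circle \<equiv> lebesgue_on {0..2 * pi}"

definition L2 :: "(real \<Rightarrow> complex) set" where
  "L2 = {u \<in> borel_measurable circle. integrable circle (\<lambda>x. (cmod (u x))\<^sup>2)}"

definition L2_inner :: "(real \<Rightarrow> complex) \<Rightarrow> (real \<Rightarrow> complex) \<Rightarrow> complex" where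
  "L2_inner u v = (LINT x|circle. u x * cnj (v x))"

definition L2_nrm :: "(real \<Rightarrow> complex) \<Rightarrow> real" where
  "L2_nrm u = sqrt (LINT x|circle. (cmod (u x))\<^sup>2)"

definition weak_deriv :: "(real \<Rightarrow> complex) \<Rightarrow> (real \<Rightarrow> complex) \<Rightarrow> bool" where
  "weak_deriv u v \<longleftrightarrow>
     (\<forall>\<phi>. smooth_on UNIV \<phi> \<and> periodic \<phi> \<longrightarrow>
        (LINT x|circle. u x * vector_derivative \<phi> (at x)) = - (LINT x|circle. v x * \<phi> x))"

definition H1 :: "(real \<Rightarrow> complex) set" where
  "H1 = {u \<in> L2. \<exists>v\<in>L2. weak_deriv u v}"

definition Dx :: "(real \<Rightarrow> complex) \<Rightarrow> real \<Rightarrow> complex" where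
  "Dx u = (\<lambda>x. (1 / \<i>) * (SOME v. v \<in> L2 \<and> weak_deriv u v) x)"

definition P_op :: "(real \<Rightarrow> complex) \<Rightarrow> real \<Rightarrow> (real \<Rightarrow> complex) \<Rightarrow> real \<Rightarrow> complex" where
  "P_op g h u = (\<lambda>x. complex_of_real h * Dx u x + g x * u x)"

definition e_fun :: "int \<Rightarrow> real \<Rightarrow> complex" where
  "e_fun k x = exp (\<i> * of_int k * complex_of_real x) / complex_of_real (sqrt (2 * pi))"

definition idx :: "real \<Rightarrow> real \<Rightarrow> (int \<times> int) set" where
  "idx C1 h = {(j, k). \<bar>j\<bar> \<le> \<lfloor>C1 / h\<rfloor> \<and> \<bar>k\<bar> \<le> \<lfloor>C1 / h\<rfloor>}"

definition Q_op ::
  "real \<Rightarrow> real \<Rightarrow> (int \<times> int \<Rightarrow> complex) \<Rightarrow> (real \<Rightarrow> complex) \<Rightarrow> real \<Rightarrow> complex" where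
  "Q_op C1 h \<alpha> u = (\<lambda>x. \<Sum>(j, k)\<in>idx C1 h. \<alpha> (j, k) * L2_inner u (e_fun k) * e_fun j x)"

definition P_pert ::
  "(real \<Rightarrow> complex) \<Rightarrow> real \<Rightarrow> real \<Rightarrow> real \<Rightarrow> (int \<times> int \<Rightarrow> complex) \<Rightarrow>
   (real \<Rightarrow> complex) \<Rightarrow> real \<Rightarrow> complex" where
  "P_pert g C1 \<delta> h \<alpha> u = (\<lambda>x. P_op g h u x + complex_of_real \<delta> * Q_op C1 h \<alpha> u x)"

text \<open>Spectrum of an unbounded operator on \<open>L\<^sup>2(S\<^sup>1)\<close> with domain \<open>X\<close>: complement of the set of \<open>z\<close>
  such that \<open>A - z : X \<rightarrow> L\<^sup>2\<close> is bijective with bounded inverse. Injectivity is part of the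
  lower bound.\<close>

definition spectrum ::
  "(real \<Rightarrow> complex) set \<Rightarrow> ((real \<Rightarrow> complex) \<Rightarrow> real \<Rightarrow> complex) \<Rightarrow> complex set" where
  "spectrum X A = - {z.
     (\<exists>c. \<forall>u\<in>X. L2_nrm u \<le> c * L2_nrm (\<lambda>x. A u x - z * u x)) \<and>
     (\<forall>f\<in>L2. \<exists>u\<in>X. AE x in circle. A u x - z * u x = f x)}"

text \<open>The law \<open>N\<^sub>C(0,1)\<close>, normalised so that \<open>E |\<alpha>|\<^sup>2 = 1\<close>, and the joint law of the independent
  coefficients.\<close>

definition cgauss :: "complex measure" where
  "cgauss = density lborel (\<lambda>z. ennreal (exp (- (cmod z)\<^sup>2) / pi))"

definition gauss_law :: "real \<Rightarrow> real \<Rightarrow> (int \<times> int \<Rightarrow> complex) measure" where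
  "gauss_law C1 h = Pi\<^sub>M (idx C1 h) (\<lambda>_. cgauss)"

definition coeff_ball :: "real \<Rightarrow> real \<Rightarrow> real \<Rightarrow> (int \<times> int \<Rightarrow> complex) set" where
  "coeff_ball C1 h R = {\<alpha>. sqrt (\<Sum>jk\<in>idx C1 h. (cmod (\<alpha> jk))\<^sup>2) < R}"

definition admissible_domain :: "(real \<Rightarrow> complex) \<Rightarrow> complex set \<Rightarrow> real \<Rightarrow> bool" where
  "admissible_domain g \<Omega> C \<longleftrightarrow>
     open \<Omega> \<and> convex \<Omega> \<and> simply_connected \<Omega> \<and>
     compact (closure \<Omega>) \<and> closure \<Omega> \<subseteq> interior (Sigma_set g) \<and>
     setdist \<Omega> (frontier (Sigma_set g)) > 1 / C"

definition coupling :: "(real \<Rightarrow> real) \<Rightarrow> real \<Rightarrow> real" where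
  "coupling \<epsilon>0 h = sqrt h * exp (- \<epsilon>0 h / h)"

text \<open>The strict bound by the minimum over the compact set \<open>closure \<Omega>\<close> is the bound at every
  point.\<close>

definition admissible_coupling ::
  "(real \<Rightarrow> complex) \<Rightarrow> real \<Rightarrow> real \<Rightarrow> complex set \<Rightarrow> real \<Rightarrow> real \<Rightarrow> (real \<Rightarrow> real) \<Rightarrow> bool" where
  "admissible_coupling g a b \<Omega> \<kappa> C0 \<epsilon>0 \<longleftrightarrow>
     (\<forall>\<^sub>F h in at_right 0.
        (\<kappa> - 1 / 2) * h * ln (1 / h) + C0 * h \<le> \<epsilon>0 h \<and>
        (\<forall>z\<in>closure \<Omega>. \<epsilon>0 h < S_fun g a b z / C0))"

text \<open>The sum ranges over ordered pairs of distinct points of the spectrum, regarded as a set.\<close>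

definition two_point_measure ::
  "(real \<Rightarrow> complex) \<Rightarrow> complex set \<Rightarrow> real \<Rightarrow> real \<Rightarrow> real \<Rightarrow> real \<Rightarrow> (complex \<times> complex) measure \<Rightarrow> bool"
  where
  "two_point_measure g \<Omega> C1 C' \<delta> h \<nu> \<longleftrightarrow>
     sets \<nu> = sets (restrict_space borel (\<Omega> \<times> \<Omega>)) \<and>
     (\<forall>A. compact A \<and> A \<subseteq> \<Omega> \<times> \<Omega> \<longrightarrow> emeasure \<nu> A < \<infinity>) \<and>
     (\<forall>\<phi> :: complex \<times> complex \<Rightarrow> complex.
        continuous_on UNIV \<phi> \<and> compact (closure {x. \<phi> x \<noteq> 0}) \<and> closure {x. \<phi> x \<noteq> 0} \<subseteq> \<Omega> \<times> \<Omega> \<longrightarrow>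
        has_bochner_integral (gauss_law C1 h)
          (\<lambda>\<alpha>. (\<Sum>\<^sub>\<infinity>x\<in>{(z, w). z \<in> spectrum H1 (P_pert g C1 \<delta> h \<alpha>) \<and>
                              w \<in> spectrum H1 (P_pert g C1 \<delta> h \<alpha>) \<and> z \<noteq> w}. \<phi> x)
               * indicator (coeff_ball C1 h (C' / h)) \<alpha>)
          (LINT x|\<nu>. \<phi> x))"

definition near_pairs :: "complex set \<Rightarrow> real \<Rightarrow> (complex \<times> complex) set" where
  "near_pairs \<Omega> C = {(z, w). z \<in> \<Omega> \<and> w \<in> \<Omega> \<and> cmod (z - w) \<le> 1 / C}"

definition D_set :: "complex set \<Rightarrow> real \<Rightarrow> real \<Rightarrow> (complex \<times> complex) set" where
  "D_set \<Omega> c h = {(z, w). z \<in> \<Omega> \<and> w \<in> \<Omega> \<and> cmod (z - w) \<le> c * h powr (3/5)}"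

definition smooth_density_on ::
  "(complex \<times> complex) set \<Rightarrow> (complex \<times> complex) measure \<Rightarrow> (complex \<Rightarrow> complex \<Rightarrow> real) \<Rightarrow> bool" where
  "smooth_density_on R \<nu> d \<longleftrightarrow>
     smooth_on R (\<lambda>(z, w). d z w) \<and> (\<forall>(z, w)\<in>R. 0 \<le> d z w) \<and>
     restrict_space \<nu> R = density (restrict_space lborel R) (\<lambda>(z, w). ennreal (d z w))"

text \<open>The filter of \<open>(h, z, w)\<close> with \<open>h \<rightarrow> 0+\<close> and \<open>(z, w) \<in> R h\<close> otherwise unconstrained, so that
  \<open>O[unif R]\<close> is an \<open>O\<close> as \<open>h \<rightarrow> 0+\<close> that is uniform over \<open>R h\<close>.\<close>

definition unif :: "(real \<Rightarrow> (complex \<times> complex) set) \<Rightarrow> (real \<times> complex \<times> complex) filter" where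
  "unif R = inf (filtercomap fst (at_right 0)) (principal {(h, zw). zw \<in> R h})"

definition O_hinf ::
  "(real \<times> complex \<times> complex) filter \<Rightarrow> (real \<times> complex \<times> complex \<Rightarrow> real) set" where
  "O_hinf F = {r. \<forall>n::nat. r \<in> O[F](\<lambda>(h, z, w). h ^ n)}"

definition K_asymp ::
  "(real \<Rightarrow> (complex \<times> complex) set) \<Rightarrow> (real \<Rightarrow> complex \<Rightarrow> complex \<Rightarrow> real) \<Rightarrow>
   (real \<Rightarrow> complex \<Rightarrow> complex \<Rightarrow> real) \<Rightarrow> bool" where
  "K_asymp R \<sigma>h K \<longleftrightarrow>
     (\<exists>r s. r \<in> O[unif R](\<lambda>(h, z, w). cmod (z - w)) \<and> s \<in> O_hinf (unif R) \<and>
        (\<forall>\<^sub>F (h, z, w) in unif R.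
           K h z w = \<sigma>h h z w * (cmod (z - w))\<^sup>2 / (4 * h) * (1 + r (h, z, w) + s (h, z, w))))"

text \<open>\<open>\<Lambda>\<close> as a function of \<open>s\<^sub>1 = \<sigma>\<^sub>h(z,z)\<close>, \<open>s\<^sub>2 = \<sigma>\<^sub>h(w,w)\<close>, \<open>s = \<sigma>\<^sub>h(z,w)\<close>, \<open>k = K\<close> and the error
  terms.\<close>

definition Lambda_expr ::
  "real \<Rightarrow> real \<Rightarrow> real \<Rightarrow> real \<Rightarrow> real \<Rightarrow> real \<Rightarrow> real \<Rightarrow> real" where
  "Lambda_expr s1 s2 s k r1 r2 r3 =
     s1 * s2 + s\<^sup>2 * (1 + r1) * exp (- 2 * k)
     + s\<^sup>2 * (1 + r2) / (exp k * sinh k) * (2 * k\<^sup>2 * (cosh k / sinh k) - 4 * k) + r3"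

definition density_formula ::
  "(real \<Rightarrow> (complex \<times> complex) set) \<Rightarrow> (real \<Rightarrow> real) \<Rightarrow> real \<Rightarrow>
   (real \<Rightarrow> complex \<Rightarrow> complex \<Rightarrow> real) \<Rightarrow> (real \<Rightarrow> complex \<Rightarrow> complex \<Rightarrow> real) \<Rightarrow>
   (real \<Rightarrow> complex \<Rightarrow> complex \<Rightarrow> real) \<Rightarrow> bool" where
  "density_formula R \<delta> D \<sigma>h K d \<longleftrightarrow>
     (\<exists>r1 r2 r3 r4 r5 r6.
        r1 \<in> O[unif R](\<lambda>(h, z, w). cmod (z - w)) \<and>
        r2 \<in> O[unif R](\<lambda>(h, z, w). cmod (z - w)) \<and>
        r3 \<in> O_hinf (unif R) \<and>
        r4 \<in> O[unif R](\<lambda>(h, z, w). \<delta> h * h powr (-32/10)) \<and>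
        r5 \<in> O[unif R](\<lambda>(h, z, w). \<delta> h * h powr (-8/5)) \<and>
        r6 \<in> O[unif R](\<lambda>(h, z, w). exp (- D / h\<^sup>2)) \<and>
        (\<forall>\<^sub>F (h, z, w) in unif R.
           d h z w =
             Lambda_expr (\<sigma>h h z z) (\<sigma>h h w w) (\<sigma>h h z w) (K h z w)
               (r1 (h, z, w)) (r2 (h, z, w)) (r3 (h, z, w) + r4 (h, z, w))
             / ((2 * pi * h)\<^sup>2 * (1 - exp (- 2 * K h z w))) * (1 + r5 (h, z, w))
             + r6 (h, z, w)))"

end

theory Submission
  imports Defs "HOL-Real_Asymp.Real_Asymp"
begin

text \<open>With \<open>G = Im g\<close> one has \<open>\<sigma>(z) = 1 / G'(x\<^sub>-) - 1 / G'(x\<^sub>+)\<close>, which on \<open>\<Omega>\<close> is Lipschitz and lies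
  between two positive constants, because \<open>Im z\<close> stays in a compact subset of the open range of \<open>G\<close>.
  Hence \<open>\<sigma>\<^sub>h(z,z) \<sigma>\<^sub>h(w,w) = \<sigma>\<^sub>h(z,w)\<^sup>2 + O(\<bar>z - w\<bar>)\<close> for \<open>h \<le> \<bar>z - w\<bar>\<close>, and \<open>K\<close> is comparable to
  \<open>\<bar>z - w\<bar>\<^sup>2 / h\<close>. For small \<open>K\<close> the Taylor expansion at \<open>0\<close> gives, up to the error terms of \<open>\<Lambda>\<close>,
  \<open>\<Lambda> / (1 - exp (- 2 * K)) = \<sigma>\<^sub>h\<^sup>2 * K + O(K\<^sup>2)\<close>. In the second regime \<open>exp (- K) \<le> h\<close>, so only
  \<open>\<sigma>\<^sub>h(z,z) \<sigma>\<^sub>h(w,w)\<close> survives. The condition \<open>\<kappa> > 52/10\<close> makes \<open>\<delta> h powr (-32/10)\<close> negligible.\<close>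

section \<open>Derivatives of \<open>Im g\<close> and bounds for \<sigma> on \<Omega>\<close>

lemma smooth_on_UNIV_derivatives:
  fixes g :: "real \<Rightarrow> complex"
  assumes "smooth_on UNIV g"
  obtains g1 g2 where "\<And>x. (g has_vector_derivative g1 x) (at x)"
    "\<And>x. (g1 has_vector_derivative g2 x) (at x)" "continuous_on UNIV g2"
proof -
  \<comment> \<open>An open superset of \<open>UNIV\<close> is \<open>UNIV\<close>, so the smooth
    extension is \<open>g\<close> itself.\<close>
  from assms have "Ck 2 UNIV g"
    unfolding smooth_on_def by (metis UNIV_I ext top.extremum_uniqueI)
  then obtain f' where f': "\<And>x. (g has_derivative f' x) (at x)" "\<And>v. Ck 1 UNIV (\<lambda>x. f' x v)"
    by (auto simp: numeral_2_eq_2)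
  \<comment> \<open>A linear map on the reals is determined by its value at \<open>1\<close>, and
    for the Frechet derivative this value is the vector derivative.\<close>
  from f'(2)[of 1] obtain f'' where
    f'': "\<And>x. ((\<lambda>x. f' x 1) has_derivative f'' x) (at x)" "continuous_on UNIV (\<lambda>x. f'' x 1)"
    by auto
  show thesis
  proof (rule that)
    show "(g has_vector_derivative f' x 1) (at x)" for x
      using f'(1)[of x] has_derivative_linear[OF f'(1)[of x]]
      by (simp add: has_vector_derivative_def linear_scale[symmetric])
    show "((\<lambda>x. f' x 1) has_vector_derivative f'' x 1) (at x)" for x
      using f''(1)[of x] has_derivative_linear[OF f''(1)[of x]]
      by (simp add: has_vector_derivative_def linear_scale[symmetric])
  qed (rule f''(2))
qed

text \<open>The Lipschitz estimate for \<open>1 / f'\<close> as a function of the value of \<open>f\<close> needs no inverse function: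
  the hull of the compact level set stays inside \<open>(l, r)\<close>, where \<open>f'\<close> is bounded away from \<open>0\<close>, so the
  mean value theorem bounds \<open>\<bar>x - y\<bar>\<close> by \<open>\<bar>f x - f y\<bar>\<close>.\<close>

lemma inverse_derivative_on_level_set:
  fixes f f1 f2 :: "real \<Rightarrow> real"
  assumes f1: "\<And>x. (f has_real_derivative f1 x) (at x)"
    and f2: "\<And>x. (f1 has_real_derivative f2 x) (at x)" "continuous_on UNIV f2"
    and nz: "\<forall>x\<in>{l<..<r}. f1 x \<noteq> 0"
    and out: "f l \<notin> {m1..m2}" "f r \<notin> {m1..m2}"
  shows "\<exists>\<mu>>0. \<exists>B>0. \<exists>L>0. \<forall>x\<in>{l..r}. f x \<in> {m1..m2} \<longrightarrow>
    \<mu> \<le> \<bar>f1 x\<bar> \<and> \<bar>f1 x\<bar> \<le> B \<and>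
    (\<forall>y\<in>{l..r}. f y \<in> {m1..m2} \<longrightarrow> \<bar>1 / f1 x - 1 / f1 y\<bar> \<le> L * \<bar>f x - f y\<bar>)"
proof -
  define E where "E = {l..r} \<inter> f -` {m1..m2}"
  have cf: "continuous_on A f" and cf1: "continuous_on A f1" and cf2: "continuous_on A f2" for A
    using f1 f2 by (auto intro: DERIV_continuous_on has_field_derivative_at_within continuous_on_subset)
  have cE: "compact E" unfolding E_def
    using continuous_closed_preimage[OF cf closed_atLeastAtMost closed_atLeastAtMost, of l r m1 m2]
    by (auto simp: compact_eq_bounded_closed intro: bounded_subset[of "{l..r}"])
  show ?thesis
  proof (cases "E = {}")
    case True
    then have "\<not> (x \<in> {l..r} \<and> f x \<in> {m1..m2})" for x by (auto simp: E_def)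
    then show ?thesis by (intro exI[of _ "1::real"] conjI) auto
  next
    case False
    obtain u v where uv: "u \<in> E" "v \<in> E" "\<And>x. x \<in> E \<Longrightarrow> u \<le> x \<and> x \<le> v"
      using compact_attains_inf[OF cE False] compact_attains_sup[OF cE False] by metis
    have lu: "l < u" "v < r" "u \<le> v"
      using uv out by (auto simp: E_def less_le)
    have "compact (f1 ` {u..v})" "compact (f2 ` {u..v})"
      using cf1 cf2 by (auto intro: compact_continuous_image)
    then obtain B B2 where B: "\<And>x. x \<in> {u..v} \<Longrightarrow> \<bar>f1 x\<bar> \<le> B" and B2: "\<And>x. x \<in> {u..v} \<Longrightarrow> \<bar>f2 x\<bar> \<le> B2"
      by (metis bounded_iff compact_imp_bounded imageI real_norm_def)
    have "continuous_on {u..v} (\<lambda>x. \<bar>f1 x\<bar>)" by (intro continuous_on_rabs cf1)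
    then obtain x0 where x0: "x0 \<in> {u..v}" "\<And>x. x \<in> {u..v} \<Longrightarrow> \<bar>f1 x0\<bar> \<le> \<bar>f1 x\<bar>"
      using continuous_attains_inf[of "{u..v}" "\<lambda>x. \<bar>f1 x\<bar>"] lu by auto
    define \<mu> where "\<mu> = \<bar>f1 x0\<bar>"
    have \<mu>: "\<mu> > 0" "\<And>x. x \<in> {u..v} \<Longrightarrow> \<mu> \<le> \<bar>f1 x\<bar>"
      using nz x0 lu by (auto simp: \<mu>_def)
    have B0: "B > 0" using B[OF x0(1)] \<mu> by (auto simp: \<mu>_def)
    have B20: "B2 \<ge> 0" using B2[OF x0(1)] by auto
    \<comment> \<open>The intermediate point stays in the hull \<open>{u..v}\<close>, where the
      bounds \<open>\<mu>\<close> and \<open>B2\<close> hold; the case \<open>x = y\<close> is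
      included so that no distinctness has to be assumed later.\<close>
    have mvt: "\<exists>\<xi>\<in>{u..v}. F x - F y = (x - y) * F1 \<xi>"
      if "\<And>x. (F has_real_derivative F1 x) (at x)" "x \<in> {u..v}" "y \<in> {u..v}" for F F1 :: "real \<Rightarrow> real" and x y
    proof (cases x y rule: linorder_cases)
      case less
      then show ?thesis using MVT2[OF less, of F F1] that 
        by (metis (no_types, opaque_lifting) atLeastAtMost_iff less_eq_real_def minus_diff_eq mult_minus_left order_trans)
    next
      case greater
      then show ?thesis using MVT2[OF greater, of F F1] that 
        by (metis (no_types, opaque_lifting) atLeastAtMost_iff less_eq_real_def order_trans)
    qed (use that in auto)
    \<comment> \<open>The two mean value estimates compare \<open>f1\<close> with \<open>f\<close>
      at cost \<open>B2 / \<mu>\<close>, and the two denominators contribute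
      \<open>1 / \<mu>^2\<close>. The added \<open>1\<close> keeps the constant positive even if
      \<open>B2 = 0\<close>.\<close>
    have lip: "\<bar>1 / f1 x - 1 / f1 y\<bar> \<le> (B2 / \<mu>^3 + 1) * \<bar>f x - f y\<bar>"
      if xy: "x \<in> {u..v}" "y \<in> {u..v}" for x y
    proof -
      obtain \<xi> where \<xi>: "\<xi> \<in> {u..v}" "f x - f y = (x - y) * f1 \<xi>" using mvt[OF f1 xy] by auto
      obtain \<eta> where \<eta>: "\<eta> \<in> {u..v}" "f1 x - f1 y = (x - y) * f2 \<eta>" using mvt[OF f2(1) xy] by auto
      have 1: "\<bar>x - y\<bar> * \<mu> \<le> \<bar>f x - f y\<bar>"
        unfolding \<xi> abs_mult using \<mu>(2)[OF \<xi>(1)] by (intro mult_left_mono) auto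
      have 2: "\<bar>f1 x - f1 y\<bar> \<le> \<bar>x - y\<bar> * B2"
        unfolding \<eta> abs_mult using B2[OF \<eta>(1)] by (intro mult_left_mono) auto
      have n: "f1 x \<noteq> 0" "f1 y \<noteq> 0" using \<mu>(2)[OF xy(1)] \<mu>(2)[OF xy(2)] \<mu>(1) by auto
      have "\<mu> * \<mu> \<le> \<bar>f1 x\<bar> * \<bar>f1 y\<bar>"
        using \<mu>(2)[OF xy(1)] \<mu>(2)[OF xy(2)] \<mu>(1) by (intro mult_mono) auto
      moreover have "\<bar>1 / f1 x - 1 / f1 y\<bar> = \<bar>f1 x - f1 y\<bar> / (\<bar>f1 x\<bar> * \<bar>f1 y\<bar>)"
        using n abs_minus_commute[of "f1 x" "f1 y"] by (simp add: diff_frac_eq abs_mult)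
      ultimately have "\<bar>1 / f1 x - 1 / f1 y\<bar> \<le> (\<bar>x - y\<bar> * B2) / (\<mu> * \<mu>)"
        using 2 \<mu>(1) by (simp only:) (rule frac_le, auto)
      also have "\<dots> = (\<bar>x - y\<bar> * \<mu>) * (B2 / \<mu>^3)"
        using \<mu>(1) by (simp add: field_simps power3_eq_cube)
      also have "\<dots> \<le> \<bar>f x - f y\<bar> * (B2 / \<mu>^3)"
        using 1 B20 \<mu>(1) by (intro mult_right_mono) auto
      finally show ?thesis by (simp add: algebra_simps)
    qed
    have inE: "x \<in> {u..v}" if "x \<in> {l..r}" "f x \<in> {m1..m2}" for x using uv(3)[of x] that by (auto simp: E_def)
    show ?thesis
      apply (rule exI[of _ \<mu>], rule conjI[OF \<mu>(1)], rule exI[of _ B], rule conjI[OF B0],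
          rule exI[of _ "B2 / \<mu>^3 + 1"], rule conjI)
      subgoal using B20 \<mu>(1) by (smt (verit) divide_nonneg_pos zero_less_power)
      subgoal using inE \<mu>(2) B lip by blast
      done
  qed
qed

lemma deriv_sign_const:
  fixes f1 :: "real \<Rightarrow> real"
  assumes "continuous_on UNIV f1" "\<And>x. l < x \<Longrightarrow> x < r \<Longrightarrow> f1 x \<noteq> 0"
    "l < x" "x < r" "f1 x > 0" "l < y" "y < r"
  shows "f1 y > 0"
proof (rule ccontr)
  assume "\<not> ?thesis"
  then have "f1 y \<le> 0" by simp
  have c: "continuous_on A f1" for A using assms(1) continuous_on_subset by blast
  have "\<exists>w. l < w \<and> w < r \<and> f1 w = 0"
  proof (cases "x \<le> y")
    case True
    from IVT2'[OF \<open>f1 y \<le> 0\<close> _ True c] assms show ?thesis by force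
  next
    case False
    from IVT'[OF \<open>f1 y \<le> 0\<close> _ _ c, of x] assms False show ?thesis by force
  qed
  then show False using assms(2) by blast
qed

text \<open>The mean value theorem on the whole interval yields one point of positive derivative; a
  continuous derivative without zeros is then positive throughout. The intermediate value theorem
  gives the preimage and Rolle's argument its uniqueness. This makes the \<open>THE\<close> in
  \<open>x_minus\<close> denote a point; the mirrored lemma does the same for
  \<open>x_plus\<close>.\<close>

lemma unique_preimage_increasing:
  fixes f f1 :: "real \<Rightarrow> real"
  assumes f1: "\<And>x. (f has_real_derivative f1 x) (at x)" and c: "continuous_on UNIV f1"
    and nz: "\<And>x. l < x \<Longrightarrow> x < r \<Longrightarrow> f1 x \<noteq> 0"
    and lr: "l < r" and t: "f l < t" "t < f r"
  shows "\<exists>!x. l < x \<and> x < r \<and> f x = t \<and> f1 x > 0"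
proof -
  have cf: "continuous_on A f" for A
    using f1 by (auto intro: DERIV_continuous_on has_field_derivative_at_within)
  obtain \<xi> where \<xi>: "l < \<xi>" "\<xi> < r" "f r - f l = (r - l) * f1 \<xi>"
    using MVT2[OF lr, of f f1] f1 by auto
  have "f1 \<xi> > 0" using \<xi>(3) t lr by (smt (verit) mult_nonneg_nonpos)
  then have pos: "f1 x > 0" if "l < x" "x < r" for x
    using deriv_sign_const[OF c nz \<xi>(1,2)] that by auto
  obtain x where x: "l \<le> x" "x \<le> r" "f x = t" using IVT'[of f l t r] t lr cf by auto
  have x': "l < x" "x < r" using x t by (auto simp: less_le)
  have "y = x" if y: "l < y" "y < r" "f y = t" for y
  proof (rule ccontr)
    assume "y \<noteq> x"
    moreover have False if uv: "u < v" "l < u" "v < r" "f u = f v" for u v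
    proof -
      obtain w where "u < w" "w < v" "f v - f u = (v - u) * f1 w" using MVT2[of u v f f1] uv(1) f1 by blast
      then show False using pos[of w] uv by auto
    qed
    ultimately show False using x' x y by (metis linorder_less_linear)
  qed
  then show ?thesis using x x' pos by blast
qed

lemma unique_preimage_decreasing:
  fixes f f1 :: "real \<Rightarrow> real"
  assumes f1: "\<And>x. (f has_real_derivative f1 x) (at x)" and c: "continuous_on UNIV f1"
    and nz: "\<And>x. l < x \<Longrightarrow> x < r \<Longrightarrow> f1 x \<noteq> 0"
    and lr: "l < r" and t: "f r < t" "t < f l"
  shows "\<exists>!x. l < x \<and> x < r \<and> f x = t \<and> f1 x < 0"
  using unique_preimage_increasing[of "\<lambda>x. - f x" "\<lambda>x. - f1 x" l r "- t"] assms
  by (auto intro!: derivative_eq_intros continuous_intros)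

text \<open>\<open>Sigma_set g\<close> lies in a closed horizontal strip, and an interior point can
  be moved a little up and down without leaving it. Hence the levels \<open>Im z\<close> that occur
  avoid the extreme values of \<open>Im g\<close>.\<close>

lemma Im_in_interior_Sigma_set:
  assumes "\<And>x. m \<le> Im (g x)" "\<And>x. Im (g x) \<le> M" "z \<in> interior (Sigma_set g)"
  shows "m < Im z" "Im z < M"
proof -
  have "closed {w. m \<le> Im w \<and> Im w \<le> M}"
    by (intro closed_Collect_conj closed_Collect_le continuous_intros)
  then have sub: "Sigma_set g \<subseteq> {w. m \<le> Im w \<and> Im w \<le> M}"
    unfolding Sigma_set_def using assms(1,2) by (intro closure_minimal) (auto simp: symb_def)
  obtain e where e: "e > 0" "ball z e \<subseteq> Sigma_set g" using assms(3) mem_interior by blast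
  have "z + \<i> * of_real (e/2) \<in> ball z e" "z - \<i> * of_real (e/2) \<in> ball z e"
    using e by (auto simp: dist_norm norm_mult)
  then have "z + \<i> * of_real (e/2) \<in> {w. m \<le> Im w \<and> Im w \<le> M}"
    "z - \<i> * of_real (e/2) \<in> {w. m \<le> Im w \<and> Im w \<le> M}"
    using e(2) sub by blast+
  then show "m < Im z" "Im z < M" using e(1) by auto
qed

text \<open>The symbol has \<xi>-derivative \<open>1\<close>, so the first bracket is
  \<open>cnj g' - g'\<close> and the second its negative.\<close>

lemma poisson_symb:
  assumes "(g has_vector_derivative g') (at x)"
  shows "poisson (symb g) (\<lambda>\<rho>. cnj (symb g \<rho>)) (x, \<xi>) = - 2 * \<i> * of_real (Im g')"
    and "poisson (\<lambda>\<rho>. cnj (symb g \<rho>)) (symb g) (x, \<xi>) = 2 * \<i> * of_real (Im g')"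
proof -
  have "vector_derivative (\<lambda>y. complex_of_real \<xi> + g y) (at x) = g'"
    by (rule vector_derivative_at) (auto intro!: derivative_eq_intros assms)
  moreover have "vector_derivative (\<lambda>y. complex_of_real \<xi> + cnj (g y)) (at x) = cnj g'"
    by (rule vector_derivative_at) (auto intro!: derivative_eq_intros has_vector_derivative_cnj assms)
  moreover have "vector_derivative (\<lambda>\<eta>. complex_of_real \<eta> + w) (at \<xi>) = 1" for w
    by (rule vector_derivative_at) (auto intro!: derivative_eq_intros)
  ultimately show "poisson (symb g) (\<lambda>\<rho>. cnj (symb g \<rho>)) (x, \<xi>) = - 2 * \<i> * of_real (Im g')"
    and "poisson (\<lambda>\<rho>. cnj (symb g \<rho>)) (symb g) (x, \<xi>) = 2 * \<i> * of_real (Im g')"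
    by (simp_all add: poisson_def symb_def complex_eq_iff)
qed

lemma sigma_bounds:
  assumes adm: "admissible g a b" and dom: "admissible_domain g \<Omega> C"
  shows "\<exists>s0>0. \<exists>S>0. \<exists>L>0. \<forall>z\<in>\<Omega>. s0 \<le> sigma g a b z \<and> sigma g a b z \<le> S \<and>
    (\<forall>w\<in>\<Omega>. \<bar>sigma g a b z - sigma g a b w\<bar> \<le> L * cmod (z - w))"
proof (cases "\<Omega> = {}")
  case True
  then show ?thesis by (intro exI[of _ "1::real"] conjI) auto
next
  case False
  from adm have per: "periodic g" and ab: "b - 2 * pi < a" "a < b"
    and crit: "{x \<in> {b - 2 * pi<..b}. deriv (\<lambda>y. Im (g y)) x = 0} = {a, b}"
    and mn: "\<And>x. Im (g a) \<le> Im (g x)" and mx: "\<And>x. Im (g x) \<le> Im (g b)"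
    and sm: "smooth_on UNIV g" by (auto simp: admissible_def)
  obtain g1 g2 where g: "\<And>x. (g has_vector_derivative g1 x) (at x)"
    "\<And>x. (g1 has_vector_derivative g2 x) (at x)" "continuous_on UNIV g2"
    using smooth_on_UNIV_derivatives[OF sm] by metis
  define f f1 f2 where "f = (\<lambda>x. Im (g x))" "f1 = (\<lambda>x. Im (g1 x))" "f2 = (\<lambda>x. Im (g2 x))"
  have f1: "\<And>x. (f has_real_derivative f1 x) (at x)" and f2: "\<And>x. (f1 has_real_derivative f2 x) (at x)"
    unfolding f_f1_f2_def using g(1,2)
    by (auto intro: bounded_linear.has_vector_derivative[OF bounded_linear_Im] simp: has_real_derivative_iff_has_vector_derivative)
  have cf2: "continuous_on UNIV f2" unfolding f_f1_f2_def using g(3) by (intro continuous_intros)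
  have cf1: "continuous_on UNIV f1" using f2 by (meson DERIV_continuous_on has_field_derivative_at_within)
  have d: "deriv (\<lambda>y. Im (g y)) = f1" using f1 by (auto simp: f_f1_f2_def(1) intro: DERIV_imp_deriv)
  have nz: "f1 x \<noteq> 0" if "b - 2*pi < x" "x < b" "x \<noteq> a" for x
    using crit[unfolded d] that by force
  \<comment> \<open>By periodicity the maximum is also attained at \<open>b - 2 * pi\<close>, so
    \<open>{b - 2 * pi..a}\<close> is a full decreasing branch and \<open>{a..b}\<close> a full
    increasing one.\<close>
  have fb: "f (b - 2 * pi) = f b" using per[unfolded periodic_def, rule_format, of "b - 2*pi"] by (simp add: f_f1_f2_def)
  have cl: "compact (closure \<Omega>)" "closure \<Omega> \<subseteq> interior (Sigma_set g)" "closure \<Omega> \<noteq> {}"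
    using dom False by (auto simp: admissible_domain_def)
  have Imb: "f a < Im z" "Im z < f b" if "z \<in> closure \<Omega>" for z
    using Im_in_interior_Sigma_set[of "Im (g a)" g "Im (g b)" z] mn mx that cl(2) by (auto simp: f_f1_f2_def)
  \<comment> \<open>The extreme imaginary parts on the compact closure bound a closed band of levels
    inside the open range of \<open>f\<close>; this keeps away from the branch end points, where
    \<open>f1\<close> vanishes.\<close>
  obtain z1 where z1: "z1 \<in> closure \<Omega>" "\<And>z. z \<in> closure \<Omega> \<Longrightarrow> Im z1 \<le> Im z"
    using continuous_attains_inf[OF cl(1,3), of Im] continuous_on_Im[OF continuous_on_id] by auto
  obtain z2 where z2: "z2 \<in> closure \<Omega>" "\<And>z. z \<in> closure \<Omega> \<Longrightarrow> Im z \<le> Im z2"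
    using continuous_attains_sup[OF cl(1,3), of Im] continuous_on_Im[OF continuous_on_id] by auto
  have ran: "Im z \<in> {Im z1..Im z2}" if "z \<in> \<Omega>" for z
    using that z1 z2 closure_subset[of \<Omega>] by auto
  have out: "f a \<notin> {Im z1..Im z2}" "f b \<notin> {Im z1..Im z2}" using Imb z1(1) z2(1) by fastforce+
  define xp xm where "xp = x_plus g a b" "xm = x_minus g a b"
  have xp: "b - 2 * pi < xp z \<and> xp z < a \<and> f (xp z) = Im z \<and> f1 (xp z) < 0" if "z \<in> \<Omega>" for z
  proof -
    have "z \<in> closure \<Omega>" using that closure_subset by blast
    then have "\<exists>!x. b - 2 * pi < x \<and> x < a \<and> f x = Im z \<and> f1 x < 0"
      using Imb[of z] fb ab by (intro unique_preimage_decreasing f1 cf1 nz) auto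
    from theI'[OF this] show ?thesis
      unfolding xp_xm_def x_plus_def d f_f1_f2_def(1) .
  qed
  have xm: "a < xm z \<and> xm z < b \<and> f (xm z) = Im z \<and> f1 (xm z) > 0" if "z \<in> \<Omega>" for z
  proof -
    have "z \<in> closure \<Omega>" using that closure_subset by blast
    then have "\<exists>!x. a < x \<and> x < b \<and> f x = Im z \<and> f1 x > 0"
      using Imb[of z] ab by (intro unique_preimage_increasing f1 cf1 nz) auto
    from theI'[OF this] show ?thesis
      unfolding xp_xm_def x_minus_def d f_f1_f2_def(1) .
  qed
  \<comment> \<open>The brackets are \<open>- 2 * \<i> * f1 (xp z)\<close> and
    \<open>2 * \<i> * f1 (xm z)\<close>; by the signs of \<open>f1\<close> both resulting terms are
    positive.\<close>
  have sig: "sigma g a b z = 1 / f1 (xm z) - 1 / f1 (xp z)" if "z \<in> \<Omega>" for z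
    using xp[OF that] xm[OF that]
    by (simp add: sigma_def rho_plus_def rho_minus_def poisson_symb[OF g(1)] f_f1_f2_def xp_xm_def
        Re_divide power2_eq_square)
  obtain \<mu> B L where p: "\<mu> > 0" "B > 0" "L > 0" 
    "\<forall>x\<in>{b-2*pi..a}. f x \<in> {Im z1..Im z2} \<longrightarrow>
    \<mu> \<le> \<bar>f1 x\<bar> \<and> \<bar>f1 x\<bar> \<le> B \<and>
    (\<forall>y\<in>{b-2*pi..a}. f y \<in> {Im z1..Im z2} \<longrightarrow> \<bar>1 / f1 x - 1 / f1 y\<bar> \<le> L * \<bar>f x - f y\<bar>)"
  proof -
    have nz': "\<forall>x\<in>{b - 2 * pi<..<a}. f1 x \<noteq> 0" using nz ab by auto
    from inverse_derivative_on_level_set[OF f1 f2 cf2 nz' out(2)[folded fb] out(1)] show ?thesis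
      by (elim exE conjE) (rule that)
  qed
  obtain \<mu>' B' L' where m: "\<mu>' > 0" "B' > 0" "L' > 0" 
    "\<forall>x\<in>{a..b}. f x \<in> {Im z1..Im z2} \<longrightarrow>
    \<mu>' \<le> \<bar>f1 x\<bar> \<and> \<bar>f1 x\<bar> \<le> B' \<and>
    (\<forall>y\<in>{a..b}. f y \<in> {Im z1..Im z2} \<longrightarrow> \<bar>1 / f1 x - 1 / f1 y\<bar> \<le> L' * \<bar>f x - f y\<bar>)"
  proof -
    have nz': "\<forall>x\<in>{a<..<b}. f1 x \<noteq> 0" using nz ab by auto
    from inverse_derivative_on_level_set[OF f1 f2 cf2 nz' out] show ?thesis
      by (elim exE conjE) (rule that)
  qed
  have xp': "xp z \<in> {b - 2*pi..a}" "f (xp z) \<in> {Im z1..Im z2}"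
    and xm': "xm z \<in> {a..b}" "f (xm z) \<in> {Im z1..Im z2}" if "z \<in> \<Omega>" for z
    using xp[OF that] xm[OF that] ran[OF that] by auto
  have P: "\<mu> \<le> \<bar>f1 (xp z)\<bar>" "\<bar>f1 (xp z)\<bar> \<le> B" "\<mu>' \<le> \<bar>f1 (xm z)\<bar>" if "z \<in> \<Omega>" for z
    using p(4) m(4) xp'[OF that] xm'[OF that] by blast+
  have Q: "\<bar>1 / f1 (xp z) - 1 / f1 (xp w)\<bar> \<le> L * \<bar>Im z - Im w\<bar>"
    "\<bar>1 / f1 (xm z) - 1 / f1 (xm w)\<bar> \<le> L' * \<bar>Im z - Im w\<bar>" if zw: "z \<in> \<Omega>" "w \<in> \<Omega>" for z w
  proof -
    have "f (xp z) = Im z" "f (xp w) = Im w" "f (xm z) = Im z" "f (xm w) = Im w"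
      using xp xm zw by auto
    then show "\<bar>1 / f1 (xp z) - 1 / f1 (xp w)\<bar> \<le> L * \<bar>Im z - Im w\<bar>"
      "\<bar>1 / f1 (xm z) - 1 / f1 (xm w)\<bar> \<le> L' * \<bar>Im z - Im w\<bar>"
      using p(4) m(4) xp'[OF zw(1)] xm'[OF zw(1)] xp'[OF zw(2)] xm'[OF zw(2)] by metis+
  qed
  show ?thesis
  proof (intro exI conjI ballI)
    \<comment> \<open>Both summands of \<sigma> are positive, so the one at \<open>xp z\<close>
      alone gives the lower bound \<open>1 / B\<close>; the upper and the Lipschitz constants add
      over the two branches.\<close>
    show "1 / B > 0" "1 / \<mu> + 1 / \<mu>' > 0" "L + L' > 0" using p(1-3) m(1-3) by (auto intro: add_pos_pos)
    fix z assume z: "z \<in> \<Omega>"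
    have "1 / B \<le> 1 / \<bar>f1 (xp z)\<bar>" "1 / \<bar>f1 (xp z)\<bar> \<le> 1 / \<mu>" "1 / \<bar>f1 (xm z)\<bar> \<le> 1 / \<mu>'"
      using P[OF z] p(1) m(1) by (intro frac_le; linarith)+
    moreover have "1 / \<bar>f1 (xp z)\<bar> = - (1 / f1 (xp z))" "1 / \<bar>f1 (xm z)\<bar> = 1 / f1 (xm z)" "1 / f1 (xm z) > 0"
      using xp[OF z] xm[OF z] by auto
    ultimately show "1 / B \<le> sigma g a b z" "sigma g a b z \<le> 1 / \<mu> + 1 / \<mu>'" 
      unfolding sig[OF z] by linarith+
    fix w assume w: "w \<in> \<Omega>"
    have "\<bar>sigma g a b z - sigma g a b w\<bar> \<le> (L + L') * \<bar>Im (z - w)\<bar>"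
      using Q[OF z w] unfolding sig[OF z] sig[OF w] minus_complex.sel distrib_right by linarith
    also have "\<dots> \<le> (L + L') * cmod (z - w)" using p(3) m(3) abs_Im_le_cmod[of "z - w"] by (intro mult_left_mono) auto
    finally show "\<bar>sigma g a b z - sigma g a b w\<bar> \<le> (L + L') * cmod (z - w)" .
  qed
qed

section \<open>Expansion of \<Lambda> for small and large \<open>K\<close>, and the density at a
  single pair\<close>

text \<open>The last \<open>K\<close>-dependent summand of \<open>Lambda_expr\<close> without its
  prefactor \<open>s\<^sup>2 * (1 + r2)\<close>; the quotient \<open>cosh k / sinh k\<close> is the
  hyperbolic cotangent.\<close>

definition Lambda_tail :: "real \<Rightarrow> real" where
  "Lambda_tail k = 1 / (exp k * sinh k) * (2 * k\<^sup>2 * (cosh k / sinh k) - 4 * k)"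

text \<open>Once \<open>s1 * s2\<close> is replaced by \<open>s\<^sup>2\<close>, the leading factor
  depends on \<open>k\<close> alone, so one-variable asymptotics apply; the second bracket collects
  the errors.\<close>

lemma Lambda_expr_split:
  "Lambda_expr s1 s2 s k r1 r2 r3 = s\<^sup>2 * (1 + exp (- 2 * k) + Lambda_tail k)
     + ((s1 * s2 - s\<^sup>2) + s\<^sup>2 * r1 * exp (- 2 * k) + s\<^sup>2 * r2 * Lambda_tail k + r3)"
proof -
  have "s\<^sup>2 * (1 + r2) / (exp k * sinh k) * (2 * k\<^sup>2 * (cosh k / sinh k) - 4 * k) = s\<^sup>2 * (1 + r2) * Lambda_tail k"
    by (simp add: Lambda_tail_def)
  then show ?thesis unfolding Lambda_expr_def by (simp add: algebra_simps)
qed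

lemma eventually_at_right_0_real:
  "eventually P (at_right (0::real)) \<longleftrightarrow> (\<exists>e>0. \<forall>k. 0 < k \<and> k \<le> e \<longrightarrow> P k)"
proof
  assume "eventually P (at_right (0::real))"
  then obtain e where "e > 0" "\<And>k. 0 < k \<Longrightarrow> k < e \<Longrightarrow> P k" by (auto simp: eventually_at_right_field)
  then show "\<exists>e>0. \<forall>k. 0 < k \<and> k \<le> e \<longrightarrow> P k" by (intro exI[of _ "e/2"]) auto
qed (use less_imp_le in \<open>unfold eventually_at_right_field, blast\<close>)

text \<open>The constant and linear Taylor terms of \<open>1 + exp (- 2 * k) + Lambda_tail k\<close> at \<open>0\<close> cancel, and
  the quadratic one is \<open>2 * k\<^sup>2\<close>: this is the quadratic repulsion of the eigenvalues.\<close>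

lemma Lambda_near_zero:
  "\<exists>k0>0. \<exists>B>0. \<forall>k. 0 < k \<and> k \<le> k0 \<longrightarrow>
     \<bar>(1 + exp (- 2 * k) + Lambda_tail k) / (1 - exp (- 2 * k)) - k\<bar> \<le> B * k\<^sup>2 \<and>
     \<bar>Lambda_tail k\<bar> \<le> B \<and> k \<le> 1 - exp (- 2 * k)"
proof -
  have 1: "(\<lambda>k. (1 + exp (- 2 * k) + Lambda_tail k) / (1 - exp (- 2 * k)) - k) \<in> O[at_right 0](\<lambda>k. k\<^sup>2)"
    unfolding Lambda_tail_def sinh_field_def cosh_field_def by real_asymp
  have 2: "Lambda_tail \<in> O[at_right 0](\<lambda>k. 1)"
    unfolding Lambda_tail_def sinh_field_def cosh_field_def by real_asymp
  have 3: "eventually (\<lambda>k::real. k \<le> 1 - exp (- 2 * k)) (at_right 0)" by real_asymp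
  obtain B1 where B1: "B1 > 0"
    and e1: "eventually (\<lambda>k. norm ((1 + exp (- 2 * k) + Lambda_tail k) / (1 - exp (- 2 * k)) - k) \<le> B1 * norm (k\<^sup>2)) (at_right 0)"
    using 1 by (rule landau_o.bigE)
  obtain B2 where B2: "B2 > 0"
    and e2: "eventually (\<lambda>k. norm (Lambda_tail k) \<le> B2 * norm (1::real)) (at_right 0)"
    using 2 by (rule landau_o.bigE)
  from e1 e2 3 have "eventually (\<lambda>k. \<bar>(1 + exp (- 2 * k) + Lambda_tail k) / (1 - exp (- 2 * k)) - k\<bar> \<le> max B1 B2 * k\<^sup>2 \<and>
     \<bar>Lambda_tail k\<bar> \<le> max B1 B2 \<and> k \<le> 1 - exp (- 2 * k)) (at_right 0)"
      proof eventually_elim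
    case (elim k)
    have "B1 * k\<^sup>2 \<le> max B1 B2 * k\<^sup>2" by (intro mult_right_mono) auto
    then show ?case using elim by (auto simp del: max_mult_distrib_right)
  qed
  then show ?thesis unfolding eventually_at_right_0_real using B1 by (metis less_max_iff_disj)
qed

text \<open>The tail behaves like \<open>2 * exp (- 2 * k)\<close> times
  \<open>2 * k\<^sup>2 - 4 * k\<close>; half of the exponential decay absorbs the
  polynomial.\<close>

lemma Lambda_tail_at_top:
  "\<exists>k1 B. B > 0 \<and> (\<forall>k\<ge>k1. \<bar>Lambda_tail k\<bar> \<le> B * exp (- k))"
proof -
  have "Lambda_tail \<in> O[at_top](\<lambda>k. exp (- k))"
    unfolding Lambda_tail_def sinh_field_def cosh_field_def by real_asymp
  then obtain B where "B > 0" "eventually (\<lambda>k. norm (Lambda_tail k) \<le> B * norm (exp (- k))) at_top"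
    by (rule landau_o.bigE)
  then show ?thesis by (auto simp: eventually_at_top_linorder)
qed

text \<open>The errors in \<open>\<Lambda>\<close> that are linear in the distance \<open>d\<close> turn into \<open>d / k \<approx> d / q\<close> after
  division by \<open>1 - exp (- 2 * k)\<close>. They are of the size \<open>q\<^sup>2\<close> of the first omitted Taylor term exactly
  when \<open>h\<^sup>3 \<le> d\<^sup>5\<close>, which is what \<open>d \<ge> h powr (4/7)\<close> provides.\<close>

lemma density_small_separation:
  fixes h d :: real
  assumes h: "0 < h" "h \<le> d" "h ^ 3 \<le> d ^ 5"
    and q: "q = d\<^sup>2 / h"
    and s: "0 < s0" "s0 \<le> s" "s \<le> S"
    and k: "k = s * q / 4 * (1 + \<rho>)" "\<bar>\<rho>\<bar> \<le> A * d" "\<bar>\<rho>\<bar> \<le> 1/2"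
    and A: "0 < A" "\<bar>s1 * s2 - s\<^sup>2\<bar> \<le> A * d" "\<bar>r1\<bar> \<le> A * d" "\<bar>r2\<bar> \<le> A * d" "\<bar>r3\<bar> \<le> A * d"
      "\<bar>r5\<bar> \<le> A * x" "0 \<le> x" "x \<le> 1" "\<bar>r6\<bar> \<le> A"
    and B: "0 < B" "\<bar>(1 + exp (- 2 * k) + Lambda_tail k) / (1 - exp (- 2 * k)) - k\<bar> \<le> B * k\<^sup>2"
      "\<bar>Lambda_tail k\<bar> \<le> B" "k \<le> 1 - exp (- 2 * k)"
    and y: "y = Lambda_expr s1 s2 s k r1 r2 r3 / ((2 * pi * h)\<^sup>2 * (1 - exp (- 2 * k))) * (1 + r5) + r6"
    and Cst: "T = S\<^sup>2 * B * S\<^sup>2 + S ^ 3 * A + (8 / s0) * (A * (2 + S\<^sup>2 * (1 + B)))"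
      "Cst = 4 / s0 ^ 3 * ((T + S ^ 3 * A) + T * A + A * (2 * pi)\<^sup>2)"
  shows "\<bar>y / (s ^ 3 * d\<^sup>2 / ((4 * pi)\<^sup>2 * h ^ 3)) - 1\<bar> \<le> Cst * (d\<^sup>2 / h + x)"
proof -
  have d0: "d > 0" and S0: "S > 0" and s1: "s > 0" using h s by linarith+
  have q0: "q > 0" using q d0 h by simp
  have hq: "h \<le> q" using h d0 unfolding q by (simp add: field_simps power2_eq_square mult_mono)
  have dq: "d \<le> q" using h d0 unfolding q by (simp add: field_simps power2_eq_square)
  \<comment> \<open>As \<open>d / q = h / d\<close> and
    \<open>q\<^sup>2 = d ^ 4 / h\<^sup>2\<close>, this is the hypothesis
    \<open>h ^ 3 \<le> d ^ 5\<close>.\<close>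
  have dq2: "d / q \<le> q\<^sup>2"
  proof -
    have "d * h ^ 3 \<le> d * d ^ 5" using h d0 by (intro mult_left_mono) auto
    then show ?thesis using d0 h unfolding q by (simp add: field_simps eval_nat_numeral)
  qed
  \<comment> \<open>\<open>1 + \<rho>\<close> lies between \<open>1/2\<close> and
    \<open>3/2\<close>, so \<open>k\<close> is comparable to \<open>q\<close>; the constants are
    rounded generously.\<close>
  have k1: "s * q / 8 \<le> k" "k \<le> s * q" 
  proof -
    have "s * q / 4 * (1/2) \<le> s * q / 4 * (1 + \<rho>)" "s * q / 4 * (1 + \<rho>) \<le> s * q / 4 * 2"
      using k(3) s1 q0 by (intro mult_left_mono; simp; linarith)+
    then show "s * q / 8 \<le> k" "k \<le> s * q" using s1 q0 k(1) mult_pos_pos[OF s1 q0] by linarith+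
  qed
  have k0: "k > 0" using k1(1) mult_pos_pos[OF s1 q0] by linarith
  define m where "m = 1 - exp (- 2 * k)"
  have m: "k \<le> m" "0 < m" using B(4) k0 by (auto simp: m_def)
  define e where "e = (s1 * s2 - s\<^sup>2) + s\<^sup>2 * r1 * exp (- 2 * k) + s\<^sup>2 * r2 * Lambda_tail k + r3"
  have s2: "s\<^sup>2 \<le> S\<^sup>2" "s ^ 3 \<le> S ^ 3" using s s1 by (auto intro: power_mono)
  have "\<bar>s\<^sup>2 * r1 * exp (- 2 * k)\<bar> \<le> S\<^sup>2 * (A * d) * 1"
    unfolding abs_mult using s2(1) A(1,3) d0 k0 by (intro mult_mono) auto
  moreover have "\<bar>s\<^sup>2 * r2 * Lambda_tail k\<bar> \<le> S\<^sup>2 * (A * d) * B"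
    unfolding abs_mult using s2(1) A(1,4) B(1,3) d0 by (intro mult_mono) auto
  ultimately have e: "\<bar>e\<bar> \<le> A * (2 + S\<^sup>2 * (1 + B)) * d"
    using A(2,5) unfolding e_def by (simp add: algebra_simps) 
  \<comment> \<open>Since \<open>m \<ge> k \<ge> s0 * q / 8\<close>, dividing by \<open>m\<close>
    turns \<open>d\<close> into a multiple of \<open>d / q\<close>, which \<open>dq2\<close> bounds
    by \<open>q\<^sup>2\<close>.\<close>
  have em: "\<bar>e / m\<bar> \<le> (8 / s0) * (A * (2 + S\<^sup>2 * (1 + B))) * q\<^sup>2"
  proof -
    have "s0 * q / 8 \<le> m" using k1(1) m(1) mult_right_mono[OF s(2), of q] q0 by linarith
    then have "\<bar>e / m\<bar> \<le> (A * (2 + S\<^sup>2 * (1 + B)) * d) / (s0 * q / 8)"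
      unfolding abs_divide using e m s(1) q0 A(1) B(1) d0 by (intro frac_le) auto
    also have "\<dots> = (8 / s0) * (A * (2 + S\<^sup>2 * (1 + B))) * (d / q)" by simp
    also have "\<dots> \<le> (8 / s0) * (A * (2 + S\<^sup>2 * (1 + B))) * q\<^sup>2" using dq2 A(1) B(1) s(1) by (intro mult_left_mono) auto
    finally show ?thesis .
  qed
  define W where "W = Lambda_expr s1 s2 s k r1 r2 r3 / m"
  \<comment> \<open>The pieces are the Taylor remainder, the deviation of \<open>k\<close> from
    \<open>s * q / 4\<close>, the errors of \<Lambda>, and the main term
    \<open>s ^ 3 * q / 4\<close>.\<close>
  have W: "W = s\<^sup>2 * ((1 + exp (- 2 * k) + Lambda_tail k) / m - k) + s\<^sup>2 * (k - s * q / 4) + e / m + s ^ 3 * q / 4"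
  proof -
    define v where "v = 1 + exp (- 2 * k) + Lambda_tail k"
    have "W = s\<^sup>2 * (v / m) + e / m"
      unfolding W_def Lambda_expr_split e_def[symmetric] v_def[symmetric] by (simp add: add_divide_distrib)
    then show ?thesis unfolding v_def[symmetric] by (simp add: algebra_simps eval_nat_numeral)
  qed
  have t1: "\<bar>s\<^sup>2 * ((1 + exp (- 2 * k) + Lambda_tail k) / m - k)\<bar> \<le> S\<^sup>2 * (B * S\<^sup>2 * q\<^sup>2)"
  proof -
    have "k\<^sup>2 \<le> (S * q)\<^sup>2" using k0 k1(2) mult_right_mono[OF s(3), of q] q0 by (intro power_mono) linarith+
    then have "B * k\<^sup>2 \<le> B * S\<^sup>2 * q\<^sup>2" using B(1) by (simp add: power_mult_distrib)
    with B(2) have "\<bar>(1 + exp (- 2 * k) + Lambda_tail k) / m - k\<bar> \<le> B * S\<^sup>2 * q\<^sup>2"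
      unfolding m_def by (rule order_trans)
    then show ?thesis unfolding abs_mult[of "s\<^sup>2"] using s2(1) by (intro mult_mono) auto
  qed
  have t2: "\<bar>s\<^sup>2 * (k - s * q / 4)\<bar> \<le> S ^ 3 * A * q\<^sup>2"
  proof -
    have "s\<^sup>2 * (k - s * q / 4) = s ^ 3 * (q / 4) * \<rho>" unfolding k(1) by (simp add: field_simps eval_nat_numeral)
    also have "\<bar>\<dots>\<bar> \<le> S ^ 3 * q * (A * q)" 
    proof -
      have "\<bar>\<rho>\<bar> \<le> A * q" using k(2) mult_left_mono[OF dq, of A] A(1) by linarith
      then show ?thesis unfolding abs_mult using s2(2) s1 S0 q0 A(1) by (intro mult_mono) auto
    qed
    finally show ?thesis by (simp add: power2_eq_square algebra_simps)
  qed
  have WT: "\<bar>W - s ^ 3 * q / 4\<bar> \<le> T * q\<^sup>2"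
    proof -
    have "\<bar>W - s ^ 3 * q / 4\<bar> \<le> S\<^sup>2 * (B * S\<^sup>2 * q\<^sup>2) + S ^ 3 * A * q\<^sup>2
        + (8 / s0) * (A * (2 + S\<^sup>2 * (1 + B))) * q\<^sup>2"
      using t1 t2 em unfolding W by linarith
    also have "\<dots> = T * q\<^sup>2" unfolding Cst(1) distrib_right by (simp only: mult.assoc)
    finally show ?thesis .
  qed
  have T0: "T \<ge> 0" unfolding Cst(1) using S0 A(1) B(1) s(1) by simp
  define Y where "Y = y * (2 * pi * h)\<^sup>2"
  have Y: "Y = W * (1 + r5) + r6 * (2 * pi * h)\<^sup>2"
  proof -
    define c where "c = (2 * pi * h)\<^sup>2"
    have "c \<noteq> 0" using h by (simp add: c_def)
    then show ?thesis unfolding Y_def y W_def m_def[symmetric] c_def[symmetric] by (simp add: distrib_right)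
  qed
  \<comment> \<open>Here \<open>r5\<close> multiplies a quantity of order \<open>q\<^sup>2\<close>,
    so its boundedness is enough; on the main term it must keep its size \<open>x\<close>, which
    yields \<open>q * x\<close>.\<close>
  have u1: "\<bar>(W - s ^ 3 * q / 4) * r5\<bar> \<le> T * A * q\<^sup>2"
  proof -
    have r5: "\<bar>r5\<bar> \<le> A" using A(6) mult_left_mono[OF A(8), of A] A(1) by linarith
    then have "\<bar>(W - s ^ 3 * q / 4) * r5\<bar> \<le> (T * q\<^sup>2) * A" 
      unfolding abs_mult[of _ r5] using WT T0 by (intro mult_mono r5) auto
    then show ?thesis by (simp add: algebra_simps)
  qed
  have u2: "\<bar>s ^ 3 * q / 4 * r5\<bar> \<le> S ^ 3 * A * (q * x)"
  proof -
    have "\<bar>s ^ 3 * q / 4 * r5\<bar> \<le> S ^ 3 * q * (A * x)"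
      unfolding abs_mult[of _ r5] 
    proof (intro mult_mono A(6))
      have "s ^ 3 * q \<le> S ^ 3 * q" using s2(2) q0 by (intro mult_right_mono) auto
      moreover have "0 \<le> s ^ 3 * q" using s1 q0 by simp
      ultimately show "\<bar>s ^ 3 * q / 4\<bar> \<le> S ^ 3 * q" by linarith
    qed (use S0 q0 in auto)
    then show ?thesis by (simp add: algebra_simps)
  qed
  \<comment> \<open>Boundedness of \<open>r6\<close> suffices because \<open>h \<le> q\<close> makes
    \<open>(2 * pi * h)\<^sup>2\<close> of order \<open>q\<^sup>2\<close>.\<close>
  have u3: "\<bar>r6 * (2 * pi * h)\<^sup>2\<bar> \<le> A * (2 * pi)\<^sup>2 * q\<^sup>2"
  proof -
    have "(2 * pi * h)\<^sup>2 \<le> (2 * pi * q)\<^sup>2" using h hq by (intro power_mono mult_left_mono) auto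
    then have "\<bar>r6 * (2 * pi * h)\<^sup>2\<bar> \<le> A * (2 * pi * q)\<^sup>2" unfolding abs_mult[of r6] using A(1) by (intro mult_mono A(9)) auto
    then show ?thesis by (simp add: power_mult_distrib algebra_simps)
  qed
  have "Y - s ^ 3 * q / 4 = (W - s ^ 3 * q / 4) + (W - s ^ 3 * q / 4) * r5 + s ^ 3 * q / 4 * r5 + r6 * (2 * pi * h)\<^sup>2"
    unfolding Y by (simp add: algebra_simps)
  then have "\<bar>Y - s ^ 3 * q / 4\<bar> \<le> T * q\<^sup>2 + T * A * q\<^sup>2 + S ^ 3 * A * (q * x) + A * (2 * pi)\<^sup>2 * q\<^sup>2"
    using WT u1 u2 u3 by linarith
  also have "\<dots> \<le> ((T + S ^ 3 * A) + T * A + A * (2 * pi)\<^sup>2) * (q * (q + x))"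
  proof -
    have "0 \<le> T * (q * x)" "0 \<le> T * A * (q * x)" "0 \<le> A * (2 * pi)\<^sup>2 * (q * x)" "0 \<le> S ^ 3 * A * q\<^sup>2"
      using T0 A(1,7) q0 S0 by (auto intro!: mult_nonneg_nonneg)
    then show ?thesis by (simp add: algebra_simps power2_eq_square)
  qed
  finally have main: "\<bar>Y - s ^ 3 * q / 4\<bar> \<le> ((T + S ^ 3 * A) + T * A + A * (2 * pi)\<^sup>2) * (q * (q + x))" .
  \<comment> \<open>\<open>(2 * pi * h)\<^sup>2 / ((4 * pi)\<^sup>2 * h ^ 3) = 1 / (4 * h)\<close>,
    so the claimed leading term of \<open>y\<close> becomes \<open>s ^ 3 * q / 4\<close> for
    \<open>Y\<close>. Dividing \<open>q * (q + x)\<close> by it leaves the relative error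
    \<open>q + x\<close>.\<close>
  have L: "y / (s ^ 3 * d\<^sup>2 / ((4 * pi)\<^sup>2 * h ^ 3)) - 1 = (Y - s ^ 3 * q / 4) / (s ^ 3 * q / 4)"
  proof -
    define s3 where "s3 = s ^ 3"
    have "s3 \<noteq> 0" using s1 by (simp add: s3_def)
    then have "y / (s3 * d\<^sup>2 / ((4 * pi)\<^sup>2 * h ^ 3)) = Y / (s3 * q / 4)"
      unfolding Y_def q using d0 h by (simp add: divide_simps power_mult_distrib power2_eq_square power3_eq_cube)
    moreover have "s3 * q / 4 \<noteq> 0" using \<open>s3 \<noteq> 0\<close> q0 by simp
    ultimately show ?thesis unfolding s3_def[symmetric] by (simp add: diff_divide_distrib)
  qed
  have "s0 ^ 3 \<le> s ^ 3" using s(1,2) by (intro power_mono) auto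
  then have l: "s0 ^ 3 * q / 4 \<le> s ^ 3 * q / 4" using q0 by simp
  have "\<bar>y / (s ^ 3 * d\<^sup>2 / ((4 * pi)\<^sup>2 * h ^ 3)) - 1\<bar> \<le>
    (((T + S ^ 3 * A) + T * A + A * (2 * pi)\<^sup>2) * (q * (q + x))) / (s0 ^ 3 * q / 4)"
    unfolding L abs_divide[of "Y - s ^ 3 * q / 4"] 
  proof (rule frac_le)
    show "\<bar>s ^ 3 * q / 4\<bar> \<ge> s0 ^ 3 * q / 4" using l by linarith
    show "0 < s0 ^ 3 * q / 4" using s(1) q0 by simp
  qed (use main in linarith)+
  also have "\<dots> = Cst * (q + x)" unfolding Cst(2) using q0 s(1) by simp (simp add: algebra_simps)
  finally show ?thesis by (simp add: q)
qed

text \<open>If \<open>exp (- k) \<le> h\<close>, every part of \<Lambda> except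
  \<open>s1 * s2\<close> is \<open>O(h)\<close> and the denominator \<open>1 - exp (- 2 * k)\<close>
  is \<open>1 + O(h)\<close>. \<open>P\<close> stands for the product of \<sigma> at the two
  points.\<close>

lemma density_large_separation:
  fixes h :: real
  assumes h: "0 < h" "h \<le> 1/2"
    and s: "\<bar>s\<bar> \<le> S" "\<bar>P\<bar> \<le> S\<^sup>2"
    and A: "0 < A" "\<bar>s1 * s2 - P\<bar> \<le> A * h" "\<bar>r1\<bar> \<le> A" "\<bar>r2\<bar> \<le> A" "\<bar>r3\<bar> \<le> A * h" "\<bar>r5\<bar> \<le> 1/2" "\<bar>r6\<bar> \<le> A"
    and B: "0 < B" "\<bar>Lambda_tail k\<bar> \<le> B * exp (- k)" "exp (- k) \<le> h"
    and y: "y = Lambda_expr s1 s2 s k r1 r2 r3 / ((2 * pi * h)\<^sup>2 * (1 - exp (- 2 * k))) * (1 + r5) + r6"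
    and Cst: "T = A + S\<^sup>2 * (1 + A) + S\<^sup>2 * ((1 + A) * B) + A" "Cst = 2 * (T + S\<^sup>2) + 2 * (A * (2 * pi)\<^sup>2)"
  shows "\<exists>r. \<bar>r\<bar> \<le> Cst * h \<and> y = (P + r) / (2 * h * pi)\<^sup>2 * (1 + r5)"
proof -
  have ek: "exp (- 2 * k) \<le> h / 2"
  proof -
    have "exp (- 2 * k) = exp (- k) * exp (- k)" by (simp flip: exp_add)
    also have "\<dots> \<le> h * (1/2)" using B(3) h by (intro mult_mono) auto
    finally show ?thesis by simp
  qed
  define m where "m = 1 - exp (- 2 * k)"
  have m: "1/2 \<le> m" "\<bar>1 - m\<bar> \<le> h" using ek h by (auto simp: m_def)
  define \<Lambda> where "\<Lambda> = Lambda_expr s1 s2 s k r1 r2 r3"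
  have "\<Lambda> - P = (s1 * s2 - P) + s\<^sup>2 * ((1 + r1) * exp (- 2 * k)) + s\<^sup>2 * ((1 + r2) * Lambda_tail k) + r3"
    unfolding \<Lambda>_def Lambda_expr_split by (simp add: algebra_simps)
  moreover have s2: "\<bar>s\<^sup>2\<bar> \<le> S\<^sup>2" using s(1) by (simp add: abs_le_square_iff[symmetric])
  moreover have "\<bar>s\<^sup>2 * ((1 + r1) * exp (- 2 * k))\<bar> \<le> S\<^sup>2 * ((1 + A) * h)"
    unfolding abs_mult using s2 A(1,3) ek h by (intro mult_mono) auto
  moreover have "\<bar>s\<^sup>2 * ((1 + r2) * Lambda_tail k)\<bar> \<le> S\<^sup>2 * ((1 + A) * (B * h))"
  proof -
    have "\<bar>Lambda_tail k\<bar> \<le> B * h" using B by (meson less_imp_le mult_left_mono order_trans)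
    then show ?thesis unfolding abs_mult using s2 A(1,4) B h by (intro mult_mono) auto
  qed
  ultimately have \<Lambda>: "\<bar>\<Lambda> - P\<bar> \<le> T * h" using A(2,5) unfolding Cst by (simp add: algebra_simps)
  have T0: "T \<ge> 0" unfolding Cst using A B by auto
  \<comment> \<open>Dividing \<open>r6\<close> by \<open>1 + r5\<close>, which is at least
    \<open>1/2\<close>, moves this additive error inside the product with
    \<open>1 + r5\<close>.\<close>
  define r where "r = (\<Lambda> / m - P) + r6 * (2 * pi * h)\<^sup>2 / (1 + r5)"
  have "\<Lambda> / m - P = ((\<Lambda> - P) + P * (1 - m)) / m" using m by (simp add: field_simps)
  also have "\<bar>\<dots>\<bar> \<le> (T * h + S\<^sup>2 * h) / (1/2)"
    unfolding abs_divide
  proof (intro frac_le)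
    have "\<bar>P * (1 - m)\<bar> \<le> S\<^sup>2 * h" unfolding abs_mult using s m h by (intro mult_mono) auto
    then show "\<bar>(\<Lambda> - P) + P * (1 - m)\<bar> \<le> T * h + S\<^sup>2 * h" using \<Lambda> by linarith
  qed (use m T0 h in auto)
  finally have 1: "\<bar>\<Lambda> / m - P\<bar> \<le> 2 * (T + S\<^sup>2) * h" by (simp add: algebra_simps)
  have "\<bar>r6 * (2 * pi * h)\<^sup>2\<bar> \<le> A * ((2 * pi)\<^sup>2 * h)"
    unfolding abs_mult using A h by (intro mult_mono) (auto simp: power_mult_distrib power2_eq_square mult_left_le)
  then have 2: "\<bar>r6 * (2 * pi * h)\<^sup>2 / (1 + r5)\<bar> \<le> (A * ((2 * pi)\<^sup>2 * h)) / (1/2)"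
    unfolding abs_divide using A h by (intro frac_le) auto
  have "\<bar>r\<bar> \<le> Cst * h" using 1 2 abs_triangle_ineq[of "\<Lambda> / m - P" "r6 * (2 * pi * h)\<^sup>2 / (1 + r5)"]
    unfolding r_def[symmetric] Cst(2) by (simp add: algebra_simps)
  moreover have "y = (P + r) / (2 * h * pi)\<^sup>2 * (1 + r5)"
  proof -
    have "1 + r5 \<noteq> 0" using A by auto
    moreover have "y = \<Lambda> / m / (2 * pi * h)\<^sup>2 * (1 + r5) + r6" unfolding y \<Lambda>_def m_def by simp
    ultimately have "y = (P + r) / (2 * pi * h)\<^sup>2 * (1 + r5)"
      unfolding r_def using m h by (simp add: divide_simps) (simp add: algebra_simps)
    then show ?thesis by (simp add: mult_ac)
  qed
  ultimately show ?thesis by blast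
qed

section \<open>The filter \<open>unif\<close> of limits uniform in \<open>(z, w)\<close>\<close>

lemma eventually_unif:
  "eventually P (unif R) \<longleftrightarrow> (\<exists>e>0. \<forall>h z w. 0 < h \<and> h < e \<and> (z, w) \<in> R h \<longrightarrow> P (h, z, w))"
proof
  assume "eventually P (unif R)"
  then obtain Q e where Q: "e > 0" "\<And>h. 0 < h \<Longrightarrow> h < e \<Longrightarrow> Q h"
    "\<And>p. Q (fst p) \<Longrightarrow> p \<in> {(h, zw). zw \<in> R h} \<Longrightarrow> P p"
    unfolding unif_def eventually_inf_principal eventually_filtercomap eventually_at_right_field by blast
  then show "\<exists>e>0. \<forall>h z w. 0 < h \<and> h < e \<and> (z, w) \<in> R h \<longrightarrow> P (h, z, w)"
    by (intro exI[of _ e]) auto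
next
  assume "\<exists>e>0. \<forall>h z w. 0 < h \<and> h < e \<and> (z, w) \<in> R h \<longrightarrow> P (h, z, w)"
  then obtain e where e: "e > 0" "\<And>h z w. 0 < h \<Longrightarrow> h < e \<Longrightarrow> (z, w) \<in> R h \<Longrightarrow> P (h, z, w)" by blast
  have "eventually (\<lambda>h. 0 < h \<and> h < e) (at_right 0)"
    unfolding eventually_at_right_field using e(1) by blast
  then show "eventually P (unif R)"
    unfolding unif_def eventually_inf_principal eventually_filtercomap using e(2) by auto
qed

text \<open>Eventual and \<open>O\<close> statements pass to smaller filters, so facts on the region
  of the density formula carry over to the two regimes inside it.\<close>

lemma unif_mono:
  assumes "\<forall>\<^sub>F h in at_right 0. R h \<subseteq> R' h"
  shows "unif R \<le> unif R'"
  unfolding le_filter_def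
proof (intro allI impI)
  fix P assume "eventually P (unif R')"
  then obtain e where e: "e > 0" "\<And>h z w. 0 < h \<Longrightarrow> h < e \<Longrightarrow> (z, w) \<in> R' h \<Longrightarrow> P (h, z, w)"
    unfolding eventually_unif by blast
  obtain e' where e': "e' > 0" "\<And>h. 0 < h \<Longrightarrow> h < e' \<Longrightarrow> R h \<subseteq> R' h"
    using assms unfolding eventually_at_right_field by auto
  show "eventually P (unif R)" unfolding eventually_unif
    using e e' by (intro exI[of _ "min e e'"]) (simp, meson subsetD)
qed

lemma eventually_unif_at_right:
  assumes "eventually P (at_right 0)"
  shows "\<forall>\<^sub>F (h, z, w) in unif R. P h"
  using assms unfolding eventually_unif eventually_at_right_field by auto

lemma eventually_unif_mem: "\<forall>\<^sub>F (h, z, w) in unif R. (z, w) \<in> R h"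
  unfolding eventually_unif by (auto intro: exI[of _ 1])

lemma unif_bigo_bound:
  assumes "r \<in> O[F](f :: real \<times> complex \<times> complex \<Rightarrow> real)"
  shows "\<exists>A>0. \<forall>\<^sub>F p in F. \<bar>r p\<bar> \<le> A * \<bar>f p\<bar>"
  using landau_o.bigE[OF assms] by auto

section \<open>Size of the coupling, products of \<open>\<sigma>h\<close>, and the scales of
  separation\<close>

text \<open>Dropping the positive term \<open>C0 * h\<close> from the lower bound on
  \<open>\<epsilon>0\<close> gives
  \<open>exp (- \<epsilon>0 h / h) \<le> h powr (\<kappa> - 1/2)\<close>; the factor
  \<open>sqrt h\<close> supplies the remaining \<open>1/2\<close>.\<close>

lemma coupling_le_powr:
  assumes "admissible_coupling g a b \<Omega> \<kappa> C0 \<epsilon>0" "C0 > 0"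
  shows "\<forall>\<^sub>F h in at_right 0. coupling \<epsilon>0 h \<le> h powr \<kappa>"
proof -
  have "\<forall>\<^sub>F h in at_right 0. (\<kappa> - 1 / 2) * h * ln (1 / h) + C0 * h \<le> \<epsilon>0 h"
    using assms(1) unfolding admissible_coupling_def by (rule eventually_mono) blast
  moreover have "\<forall>\<^sub>F h::real in at_right 0. h > 0" by (simp add: eventually_at_right_less)
  ultimately show ?thesis
  proof eventually_elim
    case (elim h)
    have "(\<kappa> - 1/2) * ln (1/h) * h \<le> \<epsilon>0 h"
      using elim mult_pos_pos[OF assms(2) elim(2)] by (simp add: mult_ac)
    then have "(\<kappa> - 1/2) * ln (1/h) \<le> \<epsilon>0 h / h" using elim(2) by (simp add: pos_le_divide_eq)
    then have "exp (- \<epsilon>0 h / h) \<le> h powr (\<kappa> - 1/2)"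
      using elim(2) by (simp add: powr_def ln_div)
    then have "coupling \<epsilon>0 h \<le> h powr (1/2) * h powr (\<kappa> - 1/2)"
      unfolding coupling_def using elim(2) by (simp add: powr_half_sqrt)
    then show ?case by (simp flip: powr_add)
  qed
qed

text \<open>The exponents \<open>\<kappa> - 8/5\<close> and \<open>\<kappa> - 32/10\<close> both
  exceed \<open>1\<close>, so for \<open>h < 1\<close> these errors are at most
  \<open>h\<close>.\<close>

lemma coupling_error_bounds:
  assumes "admissible_coupling g a b \<Omega> \<kappa> C0 \<epsilon>0" "C0 > 0" "\<kappa> > 52/10"
  shows "\<forall>\<^sub>F h in at_right 0. 0 \<le> coupling \<epsilon>0 h \<and> coupling \<epsilon>0 h * h powr (-8/5) \<le> h
    \<and> coupling \<epsilon>0 h * h powr (-32/10) \<le> h"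
proof -
  have "\<forall>\<^sub>F h::real in at_right 0. 0 < h \<and> h < 1" unfolding eventually_at_right_field by (intro exI[of _ 1]) auto
  with coupling_le_powr[OF assms(1,2)] show ?thesis
  proof eventually_elim
    case (elim h)
    have *: "coupling \<epsilon>0 h * h powr (- t) \<le> h" if "t \<le> 32/10" for t
    proof -
      have "coupling \<epsilon>0 h * h powr (- t) \<le> h powr \<kappa> * h powr (- t)"
        using elim by (intro mult_right_mono) auto
      also have "\<dots> = h powr (\<kappa> - t)" by (simp flip: powr_add)
      also have "\<dots> \<le> h powr 1" using elim assms(3) that by (intro powr_mono') auto
      finally show ?thesis using elim by simp
    qed
    show ?case using *[of "8/5"] *[of "32/10"] elim by (simp add: coupling_def)
  qed
qed

text \<open>Telescoping: each of \<open>s1 - s\<close> and \<open>s2 - s\<close> passes through the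
  values \<open>\<sigma>z\<close> or \<open>\<sigma>w\<close> and the midpoint value
  \<open>\<sigma>m\<close>, at cost \<open>2 * A * h + L * d\<close>, and \<open>h \<le> d\<close>
  absorbs the first part.\<close>

lemma sigma_products:
  fixes d h :: real
  assumes "0 < h" "h \<le> d" "0 < A" "0 < L" "0 < S"
    and m: "\<bar>\<sigma>z - \<sigma>m\<bar> \<le> L * d" "\<bar>\<sigma>w - \<sigma>m\<bar> \<le> L * d"
    and s: "\<bar>s1 - \<sigma>z\<bar> \<le> A * h" "\<bar>s2 - \<sigma>w\<bar> \<le> A * h" "\<bar>s - \<sigma>m\<bar> \<le> A * h"
    and b: "\<bar>s\<bar> \<le> 2 * S" "\<bar>s1\<bar> \<le> 2 * S"
  shows "\<bar>s1 * s2 - s\<^sup>2\<bar> \<le> 4 * S * (2 * A + L) * d"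
proof -
  have Ad: "A * h \<le> A * d" using assms by (intro mult_left_mono) auto
  have 1: "\<bar>s1 - s\<bar> \<le> (2 * A + L) * d" "\<bar>s2 - s\<bar> \<le> (2 * A + L) * d"
    unfolding distrib_right using m s Ad by linarith+
  have "\<bar>s1 * (s2 - s)\<bar> \<le> 2 * S * ((2 * A + L) * d)" "\<bar>s * (s1 - s)\<bar> \<le> 2 * S * ((2 * A + L) * d)"
    unfolding abs_mult using 1 b assms(5) by (intro mult_mono; simp)+
  moreover have "s1 * s2 - s\<^sup>2 = s1 * (s2 - s) + s * (s1 - s)" by (simp add: algebra_simps power2_eq_square)
  moreover have "4 * S * (2 * A + L) * d = 2 * S * ((2 * A + L) * d) + 2 * S * ((2 * A + L) * d)" by simp
  ultimately show ?thesis by linarith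
qed

text \<open>Comparison with \<sigma> at the two points themselves involves no Lipschitz estimate, so
  the error is \<open>O(h)\<close>. The second regime needs this, as the distance there may be of
  order \<open>1\<close>.\<close>

lemma diagonal_product:
  fixes h :: real
  assumes "0 < S" and z: "0 \<le> \<sigma>z" "\<sigma>z \<le> S"
    and s: "\<bar>s1 - \<sigma>z\<bar> \<le> A * h" "\<bar>s2 - \<sigma>w\<bar> \<le> A * h"
    and b: "\<bar>s2\<bar> \<le> 2 * S"
  shows "\<bar>s1 * s2 - \<sigma>z * \<sigma>w\<bar> \<le> 3 * S * A * h"
proof -
  have "\<bar>s2 * (s1 - \<sigma>z)\<bar> \<le> 2 * S * (A * h)" "\<bar>\<sigma>z * (s2 - \<sigma>w)\<bar> \<le> S * (A * h)"
    unfolding abs_mult using s z b assms(1) by (intro mult_mono; simp)+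
  moreover have "s1 * s2 - \<sigma>z * \<sigma>w = s2 * (s1 - \<sigma>z) + \<sigma>z * (s2 - \<sigma>w)" by (simp add: algebra_simps)
  moreover have "3 * S * A * h = 2 * S * (A * h) + S * (A * h)" by simp
  ultimately show ?thesis by linarith
qed

text \<open>Since \<open>5 * 4/7 = 20/7 < 3\<close>, the lower bound on \<open>d\<close> yields
  \<open>h ^ 3 \<le> d ^ 5\<close>. Squaring the upper bound gives
  \<open>M\<^sup>2 * d\<^sup>2 \<le> h\<close>, of which one factor \<open>M\<close> is
  kept.\<close>

lemma small_separation_scales:
  fixes h d M :: real
  assumes "0 < h" "h < 1" "M \<ge> 1" "M * h powr (4/7) \<le> d" "M * d \<le> h powr (1/2)"
  shows "h \<le> d" "d \<le> sqrt h" "h ^ 3 \<le> d ^ 5" "d\<^sup>2 / h \<le> 1 / M"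
proof -
  have l: "h powr (4/7) \<le> d" using assms(4) mult_right_mono[OF assms(3) powr_ge_zero, of h "4/7"] by linarith
  have "h powr 1 \<le> h powr (4/7)" using assms by (intro powr_mono') auto
  then show "h \<le> d" using l assms by simp
  then have d0: "d > 0" using assms by linarith
  have sq: "h powr (1/2) = sqrt h" using assms by (simp add: powr_half_sqrt)
  show "d \<le> sqrt h" using assms(5) mult_right_mono[OF assms(3), of d] d0 sq by linarith
  have "h ^ 3 = h powr 3" using assms by (simp flip: powr_numeral)
  also have "\<dots> \<le> h powr (20/7)" using assms by (intro powr_mono') auto
  also have "\<dots> = (h powr (4/7)) powr 5" by (simp add: powr_powr)
  also have "\<dots> = (h powr (4/7)) ^ 5" using assms by (simp flip: powr_numeral)
  also have "\<dots> \<le> d ^ 5" using l by (intro power_mono) auto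
  finally show "h ^ 3 \<le> d ^ 5" .
  have "(M * d)\<^sup>2 \<le> (sqrt h)\<^sup>2" using assms(3,5) d0 unfolding sq by (intro power_mono) auto
  then have "M * (M * d\<^sup>2) \<le> h" using assms(1) by (simp add: power2_eq_square mult_ac)
  moreover have "1 * (M * d\<^sup>2) \<le> M * (M * d\<^sup>2)" using assms(3) by (intro mult_right_mono) auto
  ultimately have "M * d\<^sup>2 \<le> h" by linarith
  then show "d\<^sup>2 / h \<le> 1 / M" using assms by (simp add: field_simps)
qed

lemma large_separation_scales:
  fixes h d M :: real
  assumes "0 < h" "h < 1" "M \<ge> 1" "M * (h * ln (1 / h)) powr (1/2) \<le> d"
  shows "M * ln (1 / h) \<le> d\<^sup>2 / h"
proof -
  have l: "ln (1 / h) \<ge> 0" using assms by simp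
  have "(M * sqrt (h * ln (1 / h)))\<^sup>2 \<le> d\<^sup>2"
    using assms l by (intro power_mono) (auto simp: powr_half_sqrt)
  then have "M * (M * (h * ln (1 / h))) \<le> d\<^sup>2"
    using assms l by (simp add: power_mult_distrib power2_eq_square mult_ac)
  moreover have "1 * (M * (h * ln (1 / h))) \<le> M * (M * (h * ln (1 / h)))"
    using assms l by (intro mult_right_mono) auto
  ultimately have "M * ln (1 / h) * h \<le> d\<^sup>2" by (simp add: mult_ac)
  then show ?thesis using assms(1) by (simp add: pos_le_divide_eq)
qed

section \<open>Transfer of the pointwise estimates to uniform statements\<close>

theorem theorem7:
  fixes g :: "real \<Rightarrow> complex" and a b :: real
    and \<Omega> :: "complex set"
    and C C0 C1 C' \<kappa> c D :: real
    and \<epsilon>0 :: "real \<Rightarrow> real"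
    and \<nu> :: "real \<Rightarrow> (complex \<times> complex) measure"
    and D\<delta> \<sigma>h K :: "real \<Rightarrow> complex \<Rightarrow> complex \<Rightarrow> real"
  assumes "admissible g a b"
    and "C > 1" and "admissible_domain g \<Omega> C"
    and "C1 > 0" and "C' > 0"
    and "C0 > 0" and "\<kappa> > 52/10" and "admissible_coupling g a b \<Omega> \<kappa> C0 \<epsilon>0"
    and "\<forall>\<^sub>F h in at_right 0. two_point_measure g \<Omega> C1 C' (coupling \<epsilon>0 h) h (\<nu> h)"
    and "c > 0" and "D > 0"
    and "\<forall>\<^sub>F h in at_right 0. smooth_density_on (near_pairs \<Omega> C - D_set \<Omega> c h) (\<nu> h) (D\<delta> h)"
    and "\<forall>\<^sub>F h in at_right 0. smooth_on (near_pairs \<Omega> C) (\<lambda>(z, w). \<sigma>h h z w)"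
    and "\<forall>\<^sub>F h in at_right 0. smooth_on (near_pairs \<Omega> C - D_set \<Omega> c h) (\<lambda>(z, w). K h z w)"
    and "(\<lambda>(h, z, w). \<sigma>h h z w - sigma g a b ((z + w) / 2)) \<in> O[unif (\<lambda>h. near_pairs \<Omega> C)](\<lambda>(h, z, w). h)"
    and "K_asymp (\<lambda>h. near_pairs \<Omega> C - D_set \<Omega> c h) \<sigma>h K"
    and "density_formula (\<lambda>h. near_pairs \<Omega> C - D_set \<Omega> c h) (coupling \<epsilon>0) D \<sigma>h K D\<delta>"
  shows "\<exists>C2\<ge>C. \<exists>M>0.
    (let F = unif (\<lambda>h. {(z, w) \<in> near_pairs \<Omega> C2.
                   M * h powr (4/7) \<le> cmod (z - w) \<and> M * cmod (z - w) \<le> h powr (1/2)}) in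
      \<exists>r \<in> O[F](\<lambda>(h, z, w). (cmod (z - w))\<^sup>2 / h + coupling \<epsilon>0 h * h powr (-8/5)).
        \<forall>\<^sub>F (h, z, w) in F.
          D\<delta> h z w = (\<sigma>h h z w) ^ 3 * (cmod (z - w))\<^sup>2 / ((4 * pi)\<^sup>2 * h ^ 3) * (1 + r (h, z, w))) \<and>
    (let F = unif (\<lambda>h. {(z, w) \<in> near_pairs \<Omega> C2.
                   M * (h * ln (1 / h)) powr (1/2) \<le> cmod (z - w)}) in
      \<exists>r \<in> O[F](\<lambda>(h, z, w). h). \<exists>s \<in> O[F](\<lambda>(h, z, w). coupling \<epsilon>0 h * h powr (-8/5)).
        \<forall>\<^sub>F (h, z, w) in F.
          D\<delta> h z w = (sigma g a b z * sigma g a b w + r (h, z, w)) / (2 * h * pi)\<^sup>2 * (1 + s (h, z, w)))"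
proof -
  note adm = assms(1) and C = assms(2) and dom = assms(3) and C0 = assms(6) and \<kappa> = assms(7)
    and cpl = assms(8) and c = assms(10) and D = assms(11) and \<sigma>h = assms(15)
    and Kas = assms(16) and dens = assms(17)
  define R where "R = (\<lambda>h. near_pairs \<Omega> C - D_set \<Omega> c h)"
  define \<sigma> where "\<sigma> = sigma g a b"
  define \<delta> where "\<delta> = coupling \<epsilon>0"
  obtain s0 S L where s0: "s0 > 0" and S: "S > 0" and L: "L > 0"
    and sig: "\<And>z. z \<in> \<Omega> \<Longrightarrow> s0 \<le> \<sigma> z \<and> \<sigma> z \<le> S"
      "\<And>z w. z \<in> \<Omega> \<Longrightarrow> w \<in> \<Omega> \<Longrightarrow> \<bar>\<sigma> z - \<sigma> w\<bar> \<le> L * cmod (z - w)"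
    using sigma_bounds[OF adm dom] unfolding \<sigma>_def by metis
  obtain As where As: "As > 0" and
    As_ev: "\<forall>\<^sub>F p in unif (\<lambda>h. near_pairs \<Omega> C). \<bar>case p of (h, z, w) \<Rightarrow> \<sigma>h h z w - \<sigma> ((z + w) / 2)\<bar>
        \<le> As * \<bar>case p of (h, z, w) \<Rightarrow> h\<bar>"
    using unif_bigo_bound[OF \<sigma>h] unfolding \<sigma>_def by blast
  \<comment> \<open>The bound is needed also at \<open>(z, z)\<close> and \<open>(w, w)\<close>,
    which \<open>R\<close> excludes. An explicit threshold for \<open>h\<close> makes it available
    at all three pairs at once.\<close>
  obtain es where es: "es > 0" "\<And>h z w. 0 < h \<Longrightarrow> h < es \<Longrightarrow> (z, w) \<in> near_pairs \<Omega> C \<Longrightarrow>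
      \<bar>\<sigma>h h z w - \<sigma> ((z + w) / 2)\<bar> \<le> As * h"
    using As_ev unfolding eventually_unif by (auto simp: abs_of_pos)
  from Kas obtain rk sk where rk: "rk \<in> O[unif R](\<lambda>(h, z, w). cmod (z - w))" and sk: "sk \<in> O_hinf (unif R)"
    and K_ev: "\<forall>\<^sub>F (h, z, w) in unif R.
           K h z w = \<sigma>h h z w * (cmod (z - w))\<^sup>2 / (4 * h) * (1 + rk (h, z, w) + sk (h, z, w))"
    unfolding K_asymp_def R_def by blast
  from dens obtain r1 r2 r3 r4 r5 r6 where
    r1: "r1 \<in> O[unif R](\<lambda>(h, z, w). cmod (z - w))" and
    r2: "r2 \<in> O[unif R](\<lambda>(h, z, w). cmod (z - w))" and
    r3: "r3 \<in> O_hinf (unif R)" and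
    r4: "r4 \<in> O[unif R](\<lambda>(h, z, w). \<delta> h * h powr (-32/10))" and
    r5: "r5 \<in> O[unif R](\<lambda>(h, z, w). \<delta> h * h powr (-8/5))" and
    r6: "r6 \<in> O[unif R](\<lambda>(h, z, w). exp (- D / h\<^sup>2))" and
    D_ev: "\<forall>\<^sub>F (h, z, w) in unif R.
           D\<delta> h z w =
             Lambda_expr (\<sigma>h h z z) (\<sigma>h h w w) (\<sigma>h h z w) (K h z w)
               (r1 (h, z, w)) (r2 (h, z, w)) (r3 (h, z, w) + r4 (h, z, w))
             / ((2 * pi * h)\<^sup>2 * (1 - exp (- 2 * K h z w))) * (1 + r5 (h, z, w))
             + r6 (h, z, w)"
    unfolding density_formula_def R_def \<delta>_def by blast
  have sk1: "sk \<in> O[unif R](\<lambda>(h, z, w). h ^ 1)" and r31: "r3 \<in> O[unif R](\<lambda>(h, z, w). h ^ 1)"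
    using sk r3 unfolding O_hinf_def by blast+
  obtain A1 where A1: "A1 > 0" "\<forall>\<^sub>F p in unif R. \<bar>r1 p\<bar> \<le> A1 * \<bar>case p of (h, z, w) \<Rightarrow> cmod (z - w)\<bar>"
    using unif_bigo_bound[OF r1] by blast
  obtain A2 where A2: "A2 > 0" "\<forall>\<^sub>F p in unif R. \<bar>r2 p\<bar> \<le> A2 * \<bar>case p of (h, z, w) \<Rightarrow> cmod (z - w)\<bar>"
    using unif_bigo_bound[OF r2] by blast
  obtain A3 where A3: "A3 > 0" "\<forall>\<^sub>F p in unif R. \<bar>r3 p\<bar> \<le> A3 * \<bar>case p of (h, z, w) \<Rightarrow> h ^ 1\<bar>"
    using unif_bigo_bound[OF r31] by blast
  obtain A4 where A4: "A4 > 0" "\<forall>\<^sub>F p in unif R. \<bar>r4 p\<bar> \<le> A4 * \<bar>case p of (h, z, w) \<Rightarrow> \<delta> h * h powr (-32/10)\<bar>"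
    using unif_bigo_bound[OF r4] by blast
  obtain A5 where A5: "A5 > 0" "\<forall>\<^sub>F p in unif R. \<bar>r5 p\<bar> \<le> A5 * \<bar>case p of (h, z, w) \<Rightarrow> \<delta> h * h powr (-8/5)\<bar>"
    using unif_bigo_bound[OF r5] by blast
  obtain A6 where A6: "A6 > 0" "\<forall>\<^sub>F p in unif R. \<bar>r6 p\<bar> \<le> A6 * \<bar>case p of (h, z, w) \<Rightarrow> exp (- D / h\<^sup>2)\<bar>"
    using unif_bigo_bound[OF r6] by blast
  obtain A7 where A7: "A7 > 0" "\<forall>\<^sub>F p in unif R. \<bar>rk p\<bar> \<le> A7 * \<bar>case p of (h, z, w) \<Rightarrow> cmod (z - w)\<bar>"
    using unif_bigo_bound[OF rk] by blast
  obtain A8 where A8: "A8 > 0" "\<forall>\<^sub>F p in unif R. \<bar>sk p\<bar> \<le> A8 * \<bar>case p of (h, z, w) \<Rightarrow> h ^ 1\<bar>"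
    using unif_bigo_bound[OF sk1] by blast
  \<comment> \<open>All facts that hold eventually on \<open>R\<close>, with the constants of the
    error terms made explicit; both regimes use this one predicate.\<close>
  define E where "E = (\<lambda>h z w.
     \<bar>\<sigma>h h z w - \<sigma> ((z + w) / 2)\<bar> \<le> As * h \<and> \<bar>\<sigma>h h z z - \<sigma> z\<bar> \<le> As * h \<and> \<bar>\<sigma>h h w w - \<sigma> w\<bar> \<le> As * h \<and>
     z \<in> \<Omega> \<and> w \<in> \<Omega> \<and> (z + w) / 2 \<in> \<Omega> \<and> 0 < h \<and> h < 1 \<and> cmod (z - w) \<le> 1 \<and>
     \<bar>r1 (h, z, w)\<bar> \<le> A1 * cmod (z - w) \<and> \<bar>r2 (h, z, w)\<bar> \<le> A2 * cmod (z - w) \<and>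
     \<bar>r3 (h, z, w)\<bar> \<le> A3 * h \<and> \<bar>r4 (h, z, w)\<bar> \<le> A4 * h \<and>
     \<bar>r5 (h, z, w)\<bar> \<le> A5 * (\<delta> h * h powr (-8/5)) \<and> 0 \<le> \<delta> h * h powr (-8/5) \<and> \<delta> h * h powr (-8/5) \<le> h \<and>
     \<bar>r6 (h, z, w)\<bar> \<le> A6 \<and> \<bar>rk (h, z, w)\<bar> \<le> A7 * cmod (z - w) \<and> \<bar>sk (h, z, w)\<bar> \<le> A8 * h \<and>
     K h z w = \<sigma>h h z w * (cmod (z - w))\<^sup>2 / (4 * h) * (1 + rk (h, z, w) + sk (h, z, w)) \<and>
     D\<delta> h z w =
             Lambda_expr (\<sigma>h h z z) (\<sigma>h h w w) (\<sigma>h h z w) (K h z w)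
               (r1 (h, z, w)) (r2 (h, z, w)) (r3 (h, z, w) + r4 (h, z, w))
             / ((2 * pi * h)\<^sup>2 * (1 - exp (- 2 * K h z w))) * (1 + r5 (h, z, w))
             + r6 (h, z, w))"
  have h_ev: "\<forall>\<^sub>F (h, z, w) in unif R. 0 < h \<and> h < 1 \<and> h < es"
    using es(1) unfolding eventually_unif by (intro exI[of _ "min 1 es"]) auto
  have \<delta>_ev: "\<forall>\<^sub>F (h, z, w) in unif R. 0 \<le> \<delta> h \<and> \<delta> h * h powr (-8/5) \<le> h \<and> \<delta> h * h powr (-32/10) \<le> h"
    unfolding \<delta>_def by (rule eventually_unif_at_right[OF coupling_error_bounds[OF cpl C0 \<kappa>]])
  have E_ev: "\<forall>\<^sub>F (h, z, w) in unif R. E h z w"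
    using h_ev \<delta>_ev eventually_unif_mem[of R] A1(2) A2(2) A3(2) A4(2) A5(2) A6(2) A7(2) A8(2) K_ev D_ev
  proof eventually_elim
    case (elim p)
    obtain h z w where p: "p = (h, z, w)" by (cases p)
    note e = elim[unfolded p prod.case]
    from e have h: "0 < h" "h < 1" "h < es" by auto
    have zw: "z \<in> \<Omega>" "w \<in> \<Omega>" "cmod (z - w) \<le> 1 / C" "(z, w) \<in> near_pairs \<Omega> C"
      using e(3) by (auto simp: R_def near_pairs_def)
    have zz: "(z, z) \<in> near_pairs \<Omega> C" "(w, w) \<in> near_pairs \<Omega> C"
      using zw C by (auto simp: near_pairs_def)
    \<comment> \<open>Convexity of \<Omega> puts the midpoint, at which \<open>\<sigma>h\<close> is
      compared with \<sigma>, into \<Omega>.\<close>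
    have "(1/2) *\<^sub>R z + (1/2) *\<^sub>R w \<in> \<Omega>"
      using dom zw(1,2) by (intro convexD) (auto simp: admissible_domain_def)
    then have mid: "(z + w) / 2 \<in> \<Omega>" by (simp add: scaleR_conv_of_real add_divide_distrib)
    have "1 / C \<le> 1" using C by simp
    then have le1: "cmod (z - w) \<le> 1" using zw(3) by linarith
    have \<delta>0: "0 \<le> \<delta> h" "\<delta> h * h powr (-8/5) \<le> h" "\<delta> h * h powr (-32/10) \<le> h" using e(2) by blast+
    then have x0: "0 \<le> \<delta> h * h powr t" for t by simp
    have r: "\<bar>r1 (h, z, w)\<bar> \<le> A1 * cmod (z - w)" "\<bar>r2 (h, z, w)\<bar> \<le> A2 * cmod (z - w)"
      "\<bar>r3 (h, z, w)\<bar> \<le> A3 * h" "\<bar>r5 (h, z, w)\<bar> \<le> A5 * (\<delta> h * h powr (-8/5))"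
      "\<bar>rk (h, z, w)\<bar> \<le> A7 * cmod (z - w)" "\<bar>sk (h, z, w)\<bar> \<le> A8 * h"
      using e(4,5,6,8,10,11) h(1) abs_of_nonneg[OF x0[of "-8/5"]]
      by (simp_all only: abs_norm_cancel power_one_right abs_of_pos)
    have "\<bar>r4 (h, z, w)\<bar> \<le> A4 * (\<delta> h * h powr (-32/10))"
      using e(7) by (simp only: abs_of_nonneg[OF x0[of "-32/10"]])
    then have r4': "\<bar>r4 (h, z, w)\<bar> \<le> A4 * h"
      using mult_left_mono[OF \<delta>0(3), of A4] A4(1) by linarith
    have "\<bar>r6 (h, z, w)\<bar> \<le> A6 * exp (- D / h\<^sup>2)" using e(9) by simp
    moreover have "exp (- D / h\<^sup>2) \<le> 1" using D by simp
    ultimately have r6': "\<bar>r6 (h, z, w)\<bar> \<le> A6"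
      using mult_left_mono[of "exp (- D / h\<^sup>2)" 1 A6] A6(1) by linarith
    have sg: "\<bar>\<sigma>h h z z - \<sigma> z\<bar> \<le> As * h" "\<bar>\<sigma>h h w w - \<sigma> w\<bar> \<le> As * h"
      "\<bar>\<sigma>h h z w - \<sigma> ((z + w) / 2)\<bar> \<le> As * h"
      using es(2)[OF h(1,3) zz(1)] es(2)[OF h(1,3) zz(2)] es(2)[OF h(1,3) zw(4)] by simp_all
    show ?case
      unfolding p prod.case E_def
      using sg zw(1,2) mid h(1,2) le1 r r4' r6' x0[of "-8/5"] \<delta>0(2) e(12,13) by (intro conjI) assumption+
  qed
  obtain k0 B where k0: "k0 > 0" and B: "B > 0" and near0: "\<And>k. 0 < k \<Longrightarrow> k \<le> k0 \<Longrightarrow>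
     \<bar>(1 + exp (- 2 * k) + Lambda_tail k) / (1 - exp (- 2 * k)) - k\<bar> \<le> B * k\<^sup>2 \<and>
     \<bar>Lambda_tail k\<bar> \<le> B \<and> k \<le> 1 - exp (- 2 * k)"
    using Lambda_near_zero by metis
  obtain k1 B' where B': "B' > 0" and top: "\<And>k. k \<ge> k1 \<Longrightarrow> \<bar>Lambda_tail k\<bar> \<le> B' * exp (- k)"
    using Lambda_tail_at_top by metis
  \<comment> \<open>\<open>4 * A7\<close> ensures \<open>A7 * cmod (z - w) \<le> 1/4\<close> in the
    second regime, where the distance need not tend to \<open>0\<close>. In \<open>M\<close>, the
    entry \<open>S / k0\<close> forces \<open>K \<le> k0\<close> in the first regime and
    \<open>16 / s0\<close> forces \<open>K \<ge> ln (1 / h)\<close> in the second.\<close>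
  define C2 where "C2 = max C (4 * A7)"
  define M where "M = Max {1, S / k0, 16 / s0}"
  have M: "M \<ge> 1" "M \<ge> S / k0" "M \<ge> 16 / s0" by (auto simp: M_def)
  have C2: "C2 \<ge> C" "C2 > 0" "A7 / C2 \<le> 1/4"
    using C A7(1) by (auto simp: C2_def field_simps max_def)
  have sub: "near_pairs \<Omega> C2 \<subseteq> near_pairs \<Omega> C"
  proof -
    have "1 / C2 \<le> 1 / C" using C2(1) C by (intro divide_left_mono) auto
    then show ?thesis by (auto simp: near_pairs_def)
  qed
  \<comment> \<open>An error of at most \<open>s0 / 2\<close> moves the bounds \<open>s0\<close> and
    \<open>S\<close> no further than \<open>s0 / 2\<close> and \<open>2 * S\<close>, because
    \<open>s0 \<le> S\<close>.\<close>
  have sr: "s0 / 2 \<le> \<sigma>h h z w \<and> \<bar>\<sigma>h h z w\<bar> \<le> 2 * S \<and> \<bar>\<sigma>h h z z\<bar> \<le> 2 * S \<and> \<bar>\<sigma>h h w w\<bar> \<le> 2 * S"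
    if "E h z w" "As * h \<le> s0 / 2" for h z w
  proof -
    have "z \<in> \<Omega>" "w \<in> \<Omega>" "(z + w) / 2 \<in> \<Omega>" using that(1) unfolding E_def by blast+
    then have "s0 \<le> \<sigma> z" "\<sigma> z \<le> S" "s0 \<le> \<sigma> w" "\<sigma> w \<le> S" "s0 \<le> \<sigma> ((z + w) / 2)" "\<sigma> ((z + w) / 2) \<le> S"
      using sig(1) by blast+
    moreover have "\<bar>\<sigma>h h z w - \<sigma> ((z + w) / 2)\<bar> \<le> As * h" "\<bar>\<sigma>h h z z - \<sigma> z\<bar> \<le> As * h" "\<bar>\<sigma>h h w w - \<sigma> w\<bar> \<le> As * h"
      using that(1) unfolding E_def by blast+
    ultimately show ?thesis using that(2) s0 by linarith
  qed

  \<comment> \<open>The regime of small separation\<close>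
  define F1 where "F1 = unif (\<lambda>h. {(z, w) \<in> near_pairs \<Omega> C2.
                   M * h powr (4/7) \<le> cmod (z - w) \<and> M * cmod (z - w) \<le> h powr (1/2)})"
  \<comment> \<open>As \<open>4/7 < 3/5\<close>, this regime eventually stays outside
    \<open>D_set\<close>.\<close>
  have "\<forall>\<^sub>F h in at_right 0. c * h powr (3/5) < h powr (4/7)"
    using c by real_asymp
  then have F1: "F1 \<le> unif R" unfolding F1_def
  proof (intro unif_mono, eventually_elim)
    case (elim h)
    have "\<not> d \<le> c * h powr (3/5)" if "M * h powr (4/7) \<le> d" for d
      using that elim mult_right_mono[OF M(1), of "h powr (4/7)"] by auto
    then show ?case using sub by (auto simp: R_def D_set_def)
  qed
  have "\<forall>\<^sub>F h in at_right 0. As * h \<le> s0 / 2 \<and> (A7 + A8) * sqrt h \<le> 1 / 2"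
    using s0 by (intro eventually_conj) real_asymp+
  then have h1: "\<forall>\<^sub>F (h, z, w) in F1. As * h \<le> s0 / 2 \<and> (A7 + A8) * sqrt h \<le> 1 / 2"
    unfolding F1_def by (rule eventually_unif_at_right)
  have mem1: "\<forall>\<^sub>F (h, z, w) in F1. M * h powr (4/7) \<le> cmod (z - w) \<and> M * cmod (z - w) \<le> h powr (1/2)"
    unfolding F1_def by (rule eventually_mono[OF eventually_unif_mem]) auto
  \<comment> \<open>A common bound for all error constants; the last summand is the constant of
    \<open>sigma_products\<close>.\<close>
  define A where "A = A1 + A2 + A3 + A4 + A5 + A6 + A7 + A8 + 4 * S * (2 * As + L)"
  have A: "A > 0" "A1 \<le> A" "A2 \<le> A" "A3 + A4 \<le> A" "A5 \<le> A" "A6 \<le> A" "A7 + A8 \<le> A" "4 * S * (2 * As + L) \<le> A"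
    using A1(1) A2(1) A3(1) A4(1) A5(1) A6(1) A7(1) A8(1) S As L
      mult_pos_pos[of "4 * S" "2 * As + L"] unfolding A_def by linarith+
  define T1 where "T1 = (2 * S)\<^sup>2 * B * (2 * S)\<^sup>2 + (2 * S) ^ 3 * A + (8 / (s0 / 2)) * (A * (2 + (2 * S)\<^sup>2 * (1 + B)))"
  define G1 where "G1 = 4 / (s0 / 2) ^ 3 * ((T1 + (2 * S) ^ 3 * A) + T1 * A + A * (2 * pi)\<^sup>2)"
  have "\<forall>\<^sub>F p in F1. \<exists>y. \<bar>y\<bar> \<le> G1 * (case p of (h, z, w) \<Rightarrow> (cmod (z - w))\<^sup>2 / h + \<delta> h * h powr (-8/5)) \<and>
    (case p of (h, z, w) \<Rightarrow> D\<delta> h z w = (\<sigma>h h z w) ^ 3 * (cmod (z - w))\<^sup>2 / ((4 * pi)\<^sup>2 * h ^ 3) * (1 + y))"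
    using filter_leD[OF F1 E_ev] mem1 h1
  proof eventually_elim
    case (elim p)
    obtain h z w where p: "p = (h, z, w)" by (cases p)
    note e = elim[unfolded p prod.case]
    define d where "d = cmod (z - w)"
    define q where "q = d\<^sup>2 / h"
    define x where "x = \<delta> h * h powr (-8/5)"
    define s where "s = \<sigma>h h z w"
    have E: "E h z w" using e(1) .
    have h: "0 < h" "h < 1" using E unfolding E_def by blast+
    have sc: "M * h powr (4/7) \<le> d" "M * d \<le> h powr (1/2)" using e(2) by (auto simp: d_def)
    note sc = small_separation_scales[OF h M(1) sc, folded q_def]
    have d: "0 < d" using sc(1) h by linarith
    have s: "s0 / 2 \<le> s" "\<bar>s\<bar> \<le> 2 * S" "\<bar>\<sigma>h h z z\<bar> \<le> 2 * S" using sr[OF E] e(3) by (auto simp: s_def)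
    define \<rho> where "\<rho> = rk (h, z, w) + sk (h, z, w)"
    have Ah: "t * h \<le> t * d" if "t > 0" for t using sc(1) that by simp
    have Ad: "t * d \<le> A * d" if "t \<le> A" for t using d that by (intro mult_right_mono) auto
    have "\<bar>rk (h, z, w)\<bar> \<le> A7 * d" "\<bar>sk (h, z, w)\<bar> \<le> A8 * h" using E unfolding E_def d_def by blast+
    then have \<rho>: "\<bar>\<rho>\<bar> \<le> (A7 + A8) * d" using Ah[OF A8(1)] unfolding \<rho>_def distrib_right by linarith
    have "(A7 + A8) * d \<le> (A7 + A8) * sqrt h" using sc(2) A7(1) A8(1) by (intro mult_left_mono) auto
    then have \<rho>2: "\<bar>\<rho>\<bar> \<le> 1/2" using \<rho> e(3) by linarith
    define k where "k = K h z w"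
    have k: "k = s * q / 4 * (1 + \<rho>)"
    proof -
      have "k = s * d\<^sup>2 / (4 * h) * (1 + rk (h, z, w) + sk (h, z, w))"
        using E unfolding E_def k_def s_def d_def by blast
      then show ?thesis unfolding \<rho>_def q_def by (simp add: add.assoc mult.commute)
    qed
    have q0: "0 < q" using d h by (simp add: q_def)
    have sq: "0 < s * q" using s s0 q0 by (intro mult_pos_pos) auto
    have "k > 0" unfolding k using sq \<rho>2 by (intro mult_pos_pos) linarith+
    moreover have "k \<le> k0"
    proof -
      have "s * q / 4 * (1 + \<rho>) \<le> s * q / 4 * 2" using sq \<rho>2 by (intro mult_left_mono) linarith+
      also have "\<dots> \<le> 2 * S * q / 4 * 2"
        using mult_right_mono[of s "2 * S" q] s q0 by linarith
      also have "\<dots> = S * q" by simp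
      also have "\<dots> \<le> S * (1 / M)" using sc(4) S by (intro mult_left_mono) auto
      also have "\<dots> \<le> k0" using M(1,2) k0 by (simp add: field_simps)
      finally show ?thesis unfolding k .
    qed
    ultimately have near: "\<bar>(1 + exp (- 2 * k) + Lambda_tail k) / (1 - exp (- 2 * k)) - k\<bar> \<le> B * k\<^sup>2"
      "\<bar>Lambda_tail k\<bar> \<le> B" "k \<le> 1 - exp (- 2 * k)" using near0 by blast+
    have in\<Omega>: "z \<in> \<Omega>" "w \<in> \<Omega>" "(z + w) / 2 \<in> \<Omega>" using E unfolding E_def by blast+
    have half: "cmod (z - (z + w) / 2) = d / 2" "cmod (w - (z + w) / 2) = d / 2"
    proof -
      have "z - (z + w) / 2 = (z - w) / 2" "w - (z + w) / 2 = - ((z - w) / 2)" by (simp_all add: field_simps)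
      then show "cmod (z - (z + w) / 2) = d / 2" "cmod (w - (z + w) / 2) = d / 2"
        by (simp_all only: norm_minus_cancel norm_divide d_def) simp_all
    qed
    have mid: "\<bar>\<sigma> z - \<sigma> ((z + w) / 2)\<bar> \<le> L * d" "\<bar>\<sigma> w - \<sigma> ((z + w) / 2)\<bar> \<le> L * d"
      using sig(2)[OF in\<Omega>(1,3)] sig(2)[OF in\<Omega>(2,3)] mult_pos_pos[OF L d] unfolding half by auto
    have prod: "\<bar>\<sigma>h h z z * \<sigma>h h w w - s\<^sup>2\<bar> \<le> 4 * S * (2 * As + L) * d"
    proof (rule sigma_products[OF h(1) sc(1) As L S mid _ _ _ s(2,3)])
      show "\<bar>\<sigma>h h z z - \<sigma> z\<bar> \<le> As * h" "\<bar>\<sigma>h h w w - \<sigma> w\<bar> \<le> As * h" "\<bar>s - \<sigma> ((z + w) / 2)\<bar> \<le> As * h"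
        using E unfolding E_def s_def by blast+
    qed
    have r: "\<bar>r1 (h, z, w)\<bar> \<le> A * d" "\<bar>r2 (h, z, w)\<bar> \<le> A * d" "\<bar>r3 (h, z, w) + r4 (h, z, w)\<bar> \<le> A * d"
      "\<bar>r6 (h, z, w)\<bar> \<le> A" "0 \<le> x" "x \<le> 1" "\<bar>r5 (h, z, w)\<bar> \<le> A * x"
    proof -
      have e: "\<bar>r1 (h, z, w)\<bar> \<le> A1 * d" "\<bar>r2 (h, z, w)\<bar> \<le> A2 * d" "\<bar>r3 (h, z, w)\<bar> \<le> A3 * h" "\<bar>r4 (h, z, w)\<bar> \<le> A4 * h"
        "\<bar>r6 (h, z, w)\<bar> \<le> A6" "0 \<le> x" "x \<le> h" "\<bar>r5 (h, z, w)\<bar> \<le> A5 * x"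
        using E unfolding E_def d_def x_def by blast+
      show "\<bar>r1 (h, z, w)\<bar> \<le> A * d" "\<bar>r2 (h, z, w)\<bar> \<le> A * d" using e(1,2) Ad[OF A(2)] Ad[OF A(3)] by linarith+
      show "\<bar>r3 (h, z, w) + r4 (h, z, w)\<bar> \<le> A * d"
        using e(3,4) Ah[OF A3(1)] Ah[OF A4(1)] Ad[OF A(4)] unfolding distrib_right by linarith
      show "\<bar>r6 (h, z, w)\<bar> \<le> A" "0 \<le> x" "x \<le> 1" using e A h by linarith+
      show "\<bar>r5 (h, z, w)\<bar> \<le> A * x" using e(8) mult_right_mono[OF A(5) e(6)] by linarith
    qed
    have "\<bar>D\<delta> h z w / (s ^ 3 * d\<^sup>2 / ((4 * pi)\<^sup>2 * h ^ 3)) - 1\<bar> \<le> G1 * (d\<^sup>2 / h + x)"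
    proof (rule density_small_separation[OF h(1) sc(1) sc(3) q_def _ s(1) _ k _ \<rho>2 A(1) _
          r(1,2,3,7,5,6,4) B near _ T1_def G1_def])
      show "0 < s0 / 2" "s \<le> 2 * S" using s0 s by auto
      show "\<bar>\<rho>\<bar> \<le> A * d" using \<rho> Ad[OF A(7)] by linarith
      show "\<bar>\<sigma>h h z z * \<sigma>h h w w - s\<^sup>2\<bar> \<le> A * d" using prod Ad[OF A(8)] by linarith
      show "D\<delta> h z w = Lambda_expr (\<sigma>h h z z) (\<sigma>h h w w) s k (r1 (h, z, w)) (r2 (h, z, w)) (r3 (h, z, w) + r4 (h, z, w))
             / ((2 * pi * h)\<^sup>2 * (1 - exp (- 2 * k))) * (1 + r5 (h, z, w)) + r6 (h, z, w)"
        using E unfolding E_def k_def s_def by blast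
    qed
    \<comment> \<open>The remainder is the relative error: the quotient by the leading term minus
      \<open>1\<close>.\<close>
    moreover have "s ^ 3 * d\<^sup>2 / ((4 * pi)\<^sup>2 * h ^ 3) \<noteq> 0" using s s0 d h by simp
    ultimately show ?case
      unfolding p prod.case d_def[symmetric] x_def[symmetric] s_def[symmetric]
      by (intro exI[of _ "D\<delta> h z w / (s ^ 3 * d\<^sup>2 / ((4 * pi)\<^sup>2 * h ^ 3)) - 1"]) auto
  qed
  \<comment> \<open>The remainders found at the individual points are assembled by choice into one
    function.\<close>
  then obtain Y where Y: "\<forall>\<^sub>F p in F1. \<bar>Y p\<bar> \<le> G1 * (case p of (h, z, w) \<Rightarrow> (cmod (z - w))\<^sup>2 / h + \<delta> h * h powr (-8/5)) \<and>
    (case p of (h, z, w) \<Rightarrow> D\<delta> h z w = (\<sigma>h h z w) ^ 3 * (cmod (z - w))\<^sup>2 / ((4 * pi)\<^sup>2 * h ^ 3) * (1 + Y p))"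
    unfolding eventually_ex by blast
  have part1: "\<exists>r \<in> O[F1](\<lambda>(h, z, w). (cmod (z - w))\<^sup>2 / h + \<delta> h * h powr (-8/5)).
        \<forall>\<^sub>F (h, z, w) in F1.
          D\<delta> h z w = (\<sigma>h h z w) ^ 3 * (cmod (z - w))\<^sup>2 / ((4 * pi)\<^sup>2 * h ^ 3) * (1 + r (h, z, w))"
  proof (rule bexI[of _ Y])
    show "\<forall>\<^sub>F (h, z, w) in F1.
          D\<delta> h z w = (\<sigma>h h z w) ^ 3 * (cmod (z - w))\<^sup>2 / ((4 * pi)\<^sup>2 * h ^ 3) * (1 + Y (h, z, w))"
      using Y by eventually_elim auto
    show "Y \<in> O[F1](\<lambda>(h, z, w). (cmod (z - w))\<^sup>2 / h + \<delta> h * h powr (-8/5))"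
    proof (rule bigoI[of _ "\<bar>G1\<bar>"])
      show "\<forall>\<^sub>F p in F1. norm (Y p) \<le> \<bar>G1\<bar> * norm (case p of (h, z, w) \<Rightarrow> (cmod (z - w))\<^sup>2 / h + \<delta> h * h powr (-8/5))"
        using Y
      proof eventually_elim
        case (elim p)
        then show ?case unfolding real_norm_def abs_mult[symmetric] by linarith
      qed
    qed
  qed

  \<comment> \<open>The regime of large separation\<close>
  define F2 where "F2 = unif (\<lambda>h. {(z, w) \<in> near_pairs \<Omega> C2. M * (h * ln (1 / h)) powr (1/2) \<le> cmod (z - w)})"
  \<comment> \<open>The exponent \<open>1/2\<close> is below \<open>3/5\<close> and the logarithm
    only helps, so \<open>D_set\<close> is avoided again.\<close>
  have "\<forall>\<^sub>F h in at_right 0. c * h powr (3/5) < (h * ln (1 / h)) powr (1/2)"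
    using c by real_asymp
  then have F2: "F2 \<le> unif R" unfolding F2_def
  proof (intro unif_mono, eventually_elim)
    case (elim h)
    have "\<not> d \<le> c * h powr (3/5)" if "M * (h * ln (1 / h)) powr (1/2) \<le> d" for d
      using that elim mult_right_mono[OF M(1), of "(h * ln (1 / h)) powr (1/2)"] by auto
    then show ?case using sub by (auto simp: R_def D_set_def)
  qed
  \<comment> \<open>\<open>k1 \<le> ln (1 / h)\<close> puts \<open>K\<close> beyond the threshold of
    the tail bound, and \<open>A5 * h \<le> 1 / 2\<close> keeps \<open>1 + r5\<close> away from
    \<open>0\<close>.\<close>
  have "\<forall>\<^sub>F h in at_right 0. As * h \<le> s0 / 2 \<and> A8 * h \<le> 1 / 4 \<and> A5 * h \<le> 1 / 2 \<and> h \<le> 1 / 2 \<and> k1 \<le> ln (1 / h)"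
    using s0 by (intro eventually_conj) real_asymp+
  then have h2: "\<forall>\<^sub>F (h, z, w) in F2. As * h \<le> s0 / 2 \<and> A8 * h \<le> 1 / 4 \<and> A5 * h \<le> 1 / 2 \<and> h \<le> 1 / 2 \<and> k1 \<le> ln (1 / h)"
    unfolding F2_def by (rule eventually_unif_at_right)
  have mem2: "\<forall>\<^sub>F (h, z, w) in F2. M * (h * ln (1 / h)) powr (1/2) \<le> cmod (z - w) \<and> cmod (z - w) \<le> 1 / C2"
    unfolding F2_def by (rule eventually_mono[OF eventually_unif_mem]) (auto simp: near_pairs_def)
  define A' where "A' = A + 3 * S * As"
  have A': "A' > 0" "A \<le> A'" "3 * S * As \<le> A'" using A(1) S As by (auto simp: A'_def add_pos_pos)
  define T2 where "T2 = A' + (2 * S)\<^sup>2 * (1 + A') + (2 * S)\<^sup>2 * ((1 + A') * B') + A'"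
  define G2 where "G2 = 2 * (T2 + (2 * S)\<^sup>2) + 2 * (A' * (2 * pi)\<^sup>2)"
  \<comment> \<open>The factor \<open>1 + r5\<close> is the one of the density formula; only the
    additive remainder has to be found.\<close>
  have "\<forall>\<^sub>F p in F2. \<exists>y. \<bar>y\<bar> \<le> G2 * (case p of (h, z, w) \<Rightarrow> h) \<and>
    (case p of (h, z, w) \<Rightarrow> D\<delta> h z w = (\<sigma> z * \<sigma> w + y) / (2 * h * pi)\<^sup>2 * (1 + r5 (h, z, w)))"
    using filter_leD[OF F2 E_ev] mem2 h2
  proof eventually_elim
    case (elim p)
    obtain h z w where p: "p = (h, z, w)" by (cases p)
    note e = elim[unfolded p prod.case]
    define d where "d = cmod (z - w)"
    define q where "q = d\<^sup>2 / h"
    define s where "s = \<sigma>h h z w"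
    have E: "E h z w" using e(1) .
    have h: "0 < h" "h < 1" "h \<le> 1/2" using E e(3) unfolding E_def by blast+
    have sc: "M * (h * ln (1 / h)) powr (1/2) \<le> d" and dC: "d \<le> 1 / C2" using e(2) by (auto simp: d_def)
    note sc = large_separation_scales[OF h(1,2) M(1) sc, folded q_def]
    have "d \<le> 1" using E unfolding E_def d_def by blast
    then have d: "0 \<le> d" "d \<le> 1" by (simp_all add: d_def)
    have s: "s0 / 2 \<le> s" "\<bar>s\<bar> \<le> 2 * S" "\<bar>\<sigma>h h w w\<bar> \<le> 2 * S" using sr[OF E] e(3) by (auto simp: s_def)
    define \<rho> where "\<rho> = rk (h, z, w) + sk (h, z, w)"
    have "A7 * d \<le> A7 / C2" using mult_left_mono[OF dC, of A7] A7(1) by simp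
    then have "A7 * d \<le> 1/4" using C2(3) by linarith
    moreover have "\<bar>rk (h, z, w)\<bar> \<le> A7 * d" "\<bar>sk (h, z, w)\<bar> \<le> A8 * h" using E unfolding E_def d_def by blast+
    ultimately have \<rho>: "\<bar>\<rho>\<bar> \<le> 1/2" using e(3) unfolding \<rho>_def by linarith
    define k where "k = K h z w"
    have k: "k = s * q / 4 * (1 + \<rho>)"
    proof -
      have "k = s * d\<^sup>2 / (4 * h) * (1 + rk (h, z, w) + sk (h, z, w))"
        using E unfolding E_def k_def s_def d_def by blast
      then show ?thesis unfolding \<rho>_def q_def by (simp add: add.assoc mult.commute)
    qed
    have l0: "0 \<le> ln (1 / h)" using h by simp
    have q0: "0 \<le> q" using h by (simp add: q_def)
    \<comment> \<open>\<open>s \<ge> s0 / 2\<close> and \<open>1 + \<rho> \<ge> 1/2\<close> leave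
      the factor \<open>s0 / 16\<close> in front of \<open>q\<close>, which
      \<open>M \<ge> 16 / s0\<close> compensates.\<close>
    have kl: "ln (1 / h) \<le> k"
    proof -
      have "1 * ln (1 / h) \<le> (s0 / 16 * M) * ln (1 / h)"
        using M(3) s0 l0 by (intro mult_right_mono) (auto simp: field_simps)
      also have "\<dots> \<le> s0 / 16 * q"
        using mult_left_mono[OF sc, of "s0 / 16"] s0 by simp
      also have "\<dots> = (s0 / 2) * q / 4 * (1/2)" by simp
      also have "\<dots> \<le> s * q / 4 * (1 + \<rho>)"
      proof (rule mult_mono)
        show "s0 / 2 * q / 4 \<le> s * q / 4" using s q0 by (intro divide_right_mono mult_right_mono) auto
        show "0 \<le> s * q / 4" using s s0 q0 by simp
      qed (use \<rho> in auto)
      finally show ?thesis unfolding k by simp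
    qed
    have "exp (- k) \<le> exp (- ln (1 / h))" using kl by simp
    then have ek: "exp (- k) \<le> h" using h by (simp add: ln_div)
    have tk: "\<bar>Lambda_tail k\<bar> \<le> B' * exp (- k)" using top[of k] kl e(3) by linarith
    have in\<Omega>: "z \<in> \<Omega>" "w \<in> \<Omega>" using E unfolding E_def by blast+
    have sz: "s0 \<le> \<sigma> z" "\<sigma> z \<le> S" "s0 \<le> \<sigma> w" "\<sigma> w \<le> S" using sig(1) in\<Omega> by auto
    have prod: "\<bar>\<sigma>h h z z * \<sigma>h h w w - \<sigma> z * \<sigma> w\<bar> \<le> 3 * S * As * h"
    proof (rule diagonal_product[OF S _ sz(2) _ _ s(3)])
      show "0 \<le> \<sigma> z" using sz s0 by linarith
      show "\<bar>\<sigma>h h z z - \<sigma> z\<bar> \<le> As * h" "\<bar>\<sigma>h h w w - \<sigma> w\<bar> \<le> As * h"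
        using E unfolding E_def by blast+
    qed
    have P: "\<bar>\<sigma> z * \<sigma> w\<bar> \<le> (2 * S)\<^sup>2"
      unfolding abs_mult power2_eq_square using sz s0 by (intro mult_mono) auto
    have Ah: "t * h \<le> A' * h" if "t \<le> A'" for t using h that by (intro mult_right_mono) auto
    have r: "\<bar>r1 (h, z, w)\<bar> \<le> A'" "\<bar>r2 (h, z, w)\<bar> \<le> A'" "\<bar>r3 (h, z, w) + r4 (h, z, w)\<bar> \<le> A' * h"
      "\<bar>r6 (h, z, w)\<bar> \<le> A'" "\<bar>r5 (h, z, w)\<bar> \<le> 1/2"
    proof -
      have e': "\<bar>r1 (h, z, w)\<bar> \<le> A1 * d" "\<bar>r2 (h, z, w)\<bar> \<le> A2 * d" "\<bar>r3 (h, z, w)\<bar> \<le> A3 * h" "\<bar>r4 (h, z, w)\<bar> \<le> A4 * h"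
        "\<bar>r6 (h, z, w)\<bar> \<le> A6" "\<delta> h * h powr (-8/5) \<le> h" "\<bar>r5 (h, z, w)\<bar> \<le> A5 * (\<delta> h * h powr (-8/5))"
        using E unfolding E_def d_def by blast+
      have "A1 * d \<le> A1" "A2 * d \<le> A2" using d A1(1) A2(1) by (auto intro: mult_left_le)
      then show "\<bar>r1 (h, z, w)\<bar> \<le> A'" "\<bar>r2 (h, z, w)\<bar> \<le> A'" using e'(1,2) A A' by linarith+
      show "\<bar>r3 (h, z, w) + r4 (h, z, w)\<bar> \<le> A' * h"
        using e'(3,4) Ah[of "A3 + A4"] A(4) A'(2) unfolding distrib_right by linarith
      show "\<bar>r6 (h, z, w)\<bar> \<le> A'" using e' A A' by linarith
      show "\<bar>r5 (h, z, w)\<bar> \<le> 1/2" using e'(7) mult_left_mono[OF e'(6), of A5] A5(1) e(3) by linarith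
    qed
    have "\<exists>y. \<bar>y\<bar> \<le> G2 * h \<and> D\<delta> h z w = (\<sigma> z * \<sigma> w + y) / (2 * h * pi)\<^sup>2 * (1 + r5 (h, z, w))"
    proof (rule density_large_separation[OF h(1,3) s(2) P A'(1) _ r(1,2,3,5,4) B' tk ek _ T2_def G2_def])
      show "\<bar>\<sigma>h h z z * \<sigma>h h w w - \<sigma> z * \<sigma> w\<bar> \<le> A' * h" using prod Ah[OF A'(3)] by linarith
      show "D\<delta> h z w = Lambda_expr (\<sigma>h h z z) (\<sigma>h h w w) s k (r1 (h, z, w)) (r2 (h, z, w)) (r3 (h, z, w) + r4 (h, z, w))
             / ((2 * pi * h)\<^sup>2 * (1 - exp (- 2 * k))) * (1 + r5 (h, z, w)) + r6 (h, z, w)"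
        using E unfolding E_def k_def s_def by blast
    qed
    then show ?case unfolding p prod.case .
  qed
  then obtain Z where Z: "\<forall>\<^sub>F p in F2. \<bar>Z p\<bar> \<le> G2 * (case p of (h, z, w) \<Rightarrow> h) \<and>
    (case p of (h, z, w) \<Rightarrow> D\<delta> h z w = (\<sigma> z * \<sigma> w + Z p) / (2 * h * pi)\<^sup>2 * (1 + r5 (h, z, w)))"
    unfolding eventually_ex by blast
  have part2: "\<exists>r \<in> O[F2](\<lambda>(h, z, w). h). \<exists>s \<in> O[F2](\<lambda>(h, z, w). \<delta> h * h powr (-8/5)).
        \<forall>\<^sub>F (h, z, w) in F2.
          D\<delta> h z w = (\<sigma> z * \<sigma> w + r (h, z, w)) / (2 * h * pi)\<^sup>2 * (1 + s (h, z, w))"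
  proof (rule bexI[of _ Z], rule bexI[of _ r5])
    show "\<forall>\<^sub>F (h, z, w) in F2. D\<delta> h z w = (\<sigma> z * \<sigma> w + Z (h, z, w)) / (2 * h * pi)\<^sup>2 * (1 + r5 (h, z, w))"
      using Z by eventually_elim auto
    show "r5 \<in> O[F2](\<lambda>(h, z, w). \<delta> h * h powr (-8/5))"
      using landau_o.big.filter_mono[OF F2 r5] .
    show "Z \<in> O[F2](\<lambda>(h, z, w). h)"
    proof (rule bigoI[of _ "\<bar>G2\<bar>"])
      show "\<forall>\<^sub>F p in F2. norm (Z p) \<le> \<bar>G2\<bar> * norm (case p of (h, z, w) \<Rightarrow> h)"
        using Z
      proof eventually_elim
        case (elim p)
        then show ?case unfolding real_norm_def abs_mult[symmetric] by linarith
      qed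
    qed
  qed
  show ?thesis
    unfolding Let_def
    using part1 part2 C2(1) M(1) unfolding F1_def F2_def \<delta>_def \<sigma>_def
    by (intro exI[of _ C2] exI[of _ M] conjI) auto
qed

end
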